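(* Let $p$ be an odd prime. There are soluble fusion systems (on finite $p$-groups) which are not $p$-stable.
   Context: All fusion systems are saturated fusion systems in the usual sense; maps are written on the right. Let $\mathcal{F}$ be a fusion system on a finite $p$-group $P$. $Q\le P$ is fully $\mathcal{F}$-normalised if $|N_P(Q)|\ge |N_P(Q\phi)|$ for every $\mathcal{F}$-morphism $\phi$ with domain $Q$. For such $Q$, $\mathcal{N}_{\mathcal{F}}(Q)$ is the subsystem on $N_P(Q)$ whose morphisms $R\to T$ are the $\mathcal{F}$-morphisms extending to an $\mathcal{F}$-morphism $RQ\to TQ$ that restricts to an automorphism of $Q$. $Q$ is normal in $\mathcal{F}$ ($Q\triangleleft\mathcal{F}$) if $\mathcal{N}_{\mathcal{F}}(Q)=\mathcal{F}$; then $\mathcal{F}/Q$ is the fusion system on $P/Q$ whose morphisms $T/Q\to R/Q$ are those induced by $\mathcal{F}$-morphisms $T\to R$. $\mathcal{F}$ is soluble if there is a chain $1=Q_0<Q_1<\dots<Q_r=P$ with $Q_i/Q_{i-1}\triangleleft\mathcal{F}/Q_{i-1}$ for all $1\le i\le r$. $\mathcal{F}$ is $p$-stable if for every fully $\mathcal{F}$-normalised $Q\le P$, whenever $\chi\in\mathrm{Aut}_{\mathcal{F}}(Q)$ satisfies $(a^{-1})^{\chi}\, a\, (a^{-1})^{\chi}\, a^{\chi^2}=1$ for all $a\in Q$, then $\chi\in O_p(\mathrm{Aut}_{\mathcal{F}}(Q))$. *)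

theory Defs
  imports "HOL-Algebra.Bij" "HOL-Algebra.Group_Action" "HOL-Algebra.Generated_Groups"
    "HOL-Computational_Algebra.Primes"
begin

definition finite_p_group :: "nat \<Rightarrow> 'a monoid \<Rightarrow> bool" where
  "finite_p_group p G \<longleftrightarrow> group G \<and> finite (carrier G) \<and> (\<exists>n. order G = p ^ n)"

definition sylow_subgroup :: "nat \<Rightarrow> 'a monoid \<Rightarrow> 'a set \<Rightarrow> bool" where
  "sylow_subgroup p G H \<longleftrightarrow> subgroup H G \<and> card H = p ^ multiplicity p (order G)"

definition p_core :: "nat \<Rightarrow> 'a monoid \<Rightarrow> 'a set" where
  "p_core p G = generate G (\<Union>{N. N \<lhd> G \<and> (\<exists>n. card N = p ^ n)})"

text \<open>
  A fusion system is a category whose objects are the subgroups of the base group \<open>P\<close>;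
  \<open>mor F Q R\<close> is the set of morphisms from \<open>Q\<close> to \<open>R\<close>.  A morphism is an extensional
  function on its domain, and \<open>mor F Q R\<close> is empty unless \<open>Q\<close> and \<open>R\<close> are subgroups of the
  base, so that record equality is equality of fusion systems.
  The applied notation \<open>\<phi> x\<close> stands for \<open>x\<phi>\<close> or \<open>x\<^sup>\<phi>\<close> in right-handed notation.
\<close>

record 'a fusion_system =
  base :: "'a monoid"
  mor :: "'a set \<Rightarrow> 'a set \<Rightarrow> ('a \<Rightarrow> 'a) set"

definition conj_maps :: "'a monoid \<Rightarrow> 'a set \<Rightarrow> 'a set \<Rightarrow> ('a \<Rightarrow> 'a) set" where
  "conj_maps P Q R =
     {(\<lambda>u\<in>Q. g \<otimes>\<^bsub>P\<^esub> u \<otimes>\<^bsub>P\<^esub> inv\<^bsub>P\<^esub> g) | g.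
        g \<in> carrier P \<and> (\<forall>u\<in>Q. g \<otimes>\<^bsub>P\<^esub> u \<otimes>\<^bsub>P\<^esub> inv\<^bsub>P\<^esub> g \<in> R)}"

text \<open>
  The axioms of a (not necessarily saturated) fusion system on a finite \<open>p\<close>-group.
  Identities and inclusions are the conjugation maps by the neutral element.
\<close>

definition fusion_on :: "nat \<Rightarrow> 'a fusion_system \<Rightarrow> bool" where
  "fusion_on p F \<longleftrightarrow>
     finite_p_group p (base F) \<and>
     (\<forall>Q R. \<forall>\<phi>\<in>mor F Q R.
        subgroup Q (base F) \<and> subgroup R (base F) \<and>
        \<phi> \<in> extensional Q \<and> inj_on \<phi> Q \<and>
        \<phi> \<in> hom (base F\<lparr>carrier := Q\<rparr>) (base F\<lparr>carrier := R\<rparr>)) \<and>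
     (\<forall>Q R. subgroup Q (base F) \<longrightarrow> subgroup R (base F) \<longrightarrow>
        conj_maps (base F) Q R \<subseteq> mor F Q R) \<and>
     (\<forall>Q R S. \<forall>\<phi>\<in>mor F Q R. \<forall>\<psi>\<in>mor F R S. compose Q \<psi> \<phi> \<in> mor F Q S) \<and>
     (\<forall>Q R. \<forall>\<phi>\<in>mor F Q R.
        \<phi> \<in> mor F Q (\<phi> ` Q) \<and> restrict (inv_into Q \<phi>) (\<phi> ` Q) \<in> mor F (\<phi> ` Q) Q)"

definition fully_normalised :: "'a fusion_system \<Rightarrow> 'a set \<Rightarrow> bool" where
  "fully_normalised F Q \<longleftrightarrow>
     subgroup Q (base F) \<and>
     (\<forall>R. \<forall>\<phi>\<in>mor F Q R.
        card (normalizer (base F) (\<phi> ` Q)) \<le> card (normalizer (base F) Q))"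

text \<open>
  The automorphism group of \<open>Q\<close> in \<open>F\<close>, a subgroup of the symmetric group on \<open>Q\<close>
  (with composition of left-handed functions, i.e.\ the opposite of the right-handed
  convention; this does not affect which subsets are Sylow subgroups or the \<open>p\<close>-core).
\<close>

definition Aut_fs :: "'a fusion_system \<Rightarrow> 'a set \<Rightarrow> ('a \<Rightarrow> 'a) monoid" where
  "Aut_fs F Q = BijGroup Q\<lparr>carrier := mor F Q Q\<rparr>"

text \<open>\<open>ext_dom F Q \<phi>\<close> is the subgroup of \<open>N\<^sub>P(Q)\<close> usually written \<open>N\<^sub>\<phi>\<close>.\<close>

definition ext_dom :: "'a fusion_system \<Rightarrow> 'a set \<Rightarrow> ('a \<Rightarrow> 'a) \<Rightarrow> 'a set" where
  "ext_dom F Q \<phi> =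
     {x \<in> normalizer (base F) Q.
        \<exists>y\<in>normalizer (base F) (\<phi> ` Q). \<forall>u\<in>Q.
          \<phi> (x \<otimes>\<^bsub>base F\<^esub> u \<otimes>\<^bsub>base F\<^esub> inv\<^bsub>base F\<^esub> x)
            = y \<otimes>\<^bsub>base F\<^esub> \<phi> u \<otimes>\<^bsub>base F\<^esub> inv\<^bsub>base F\<^esub> y}"

text \<open>
  Saturation in the form used by Kessar, Linckelmann and Stancu: the inner automorphisms
  of \<open>P\<close> form a Sylow \<open>p\<close>-subgroup of the automorphism group of \<open>P\<close>, and every morphism
  \<open>\<phi>\<close> to \<open>P\<close> with fully normalised image extends to \<open>N\<^sub>\<phi>\<close>.
\<close>

definition saturated_fusion_system :: "nat \<Rightarrow> 'a fusion_system \<Rightarrow> bool" where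
  "saturated_fusion_system p F \<longleftrightarrow>
     fusion_on p F \<and>
     sylow_subgroup p (Aut_fs F (carrier (base F)))
       (conj_maps (base F) (carrier (base F)) (carrier (base F))) \<and>
     (\<forall>Q. \<forall>\<phi>\<in>mor F Q (carrier (base F)).
        fully_normalised F (\<phi> ` Q) \<longrightarrow>
        (\<exists>\<psi>\<in>mor F (ext_dom F Q \<phi>) (carrier (base F)). restrict \<psi> Q = \<phi>))"

definition normaliser_fs :: "'a fusion_system \<Rightarrow> 'a set \<Rightarrow> 'a fusion_system" where
  "normaliser_fs F Q =
     \<lparr>base = base F\<lparr>carrier := normalizer (base F) Q\<rparr>,
      mor = (\<lambda>R T. {\<phi> \<in> mor F R T.
               R \<subseteq> normalizer (base F) Q \<and> T \<subseteq> normalizer (base F) Q \<and>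
               (\<exists>\<psi>\<in>mor F (R <#>\<^bsub>base F\<^esub> Q) (T <#>\<^bsub>base F\<^esub> Q).
                  restrict \<psi> R = \<phi> \<and> \<psi> ` Q = Q)})\<rparr>"

definition normal_in_fs :: "'a set \<Rightarrow> 'a fusion_system \<Rightarrow> bool" where
  "normal_in_fs Q F \<longleftrightarrow> fully_normalised F Q \<and> normaliser_fs F Q = F"

definition quot_set :: "'a monoid \<Rightarrow> 'a set \<Rightarrow> 'a set \<Rightarrow> 'a set set" where
  "quot_set P Q T = (\<lambda>x. Q #>\<^bsub>P\<^esub> x) ` T"

text \<open>
  The quotient by \<open>Q\<close>; a morphism \<open>\<theta>\<close> is induced by \<open>\<phi>\<close> when \<open>\<theta> (Qx) = Q(\<phi> x)\<close>.
  The definition makes sense whenever \<open>Q\<close> is normal in the base and invariant under every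
  morphism whose domain contains \<open>Q\<close>, in particular when \<open>Q\<close> is normal in \<open>F\<close>.
\<close>

definition quotient_fs :: "'a fusion_system \<Rightarrow> 'a set \<Rightarrow> 'a set fusion_system" where
  "quotient_fs F Q =
     \<lparr>base = base F Mod Q,
      mor = (\<lambda>A B. {\<theta>. \<exists>T R. \<exists>\<phi>\<in>mor F T R.
               Q \<subseteq> T \<and> Q \<subseteq> R \<and> A = quot_set (base F) Q T \<and> B = quot_set (base F) Q R \<and>
               \<theta> \<in> extensional A \<and>
               (\<forall>x\<in>T. \<theta> (Q #>\<^bsub>base F\<^esub> x) = Q #>\<^bsub>base F\<^esub> \<phi> x)})\<rparr>"

text \<open>
  Along the chain, \<open>Q i\<close> need not be normal in \<open>F\<close> for \<open>i \<ge> 2\<close>.  By induction on \<open>i\<close>,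
  however, \<open>Q i\<close> is normal in the base and invariant under every morphism whose domain
  contains it, so \<open>quotient_fs F (Q i)\<close> is meaningful; it is the iterated quotient of
  \<open>quotient_fs F (Q (i - 1))\<close> by \<open>Q i / Q (i - 1)\<close>, up to the identification of base groups.
\<close>

definition soluble_fs :: "'a fusion_system \<Rightarrow> bool" where
  "soluble_fs F \<longleftrightarrow>
     (\<exists>(r::nat) Q.
        Q 0 = {\<one>\<^bsub>base F\<^esub>} \<and> Q r = carrier (base F) \<and>
        (\<forall>i\<le>r. subgroup (Q i) (base F)) \<and>
        (\<forall>i\<in>{1..r}. Q (i - 1) \<subset> Q i \<and>
           normal_in_fs (quot_set (base F) (Q (i - 1)) (Q i)) (quotient_fs F (Q (i - 1)))))"

definition p_stable :: "nat \<Rightarrow> 'a fusion_system \<Rightarrow> bool" where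
  "p_stable p F \<longleftrightarrow>
     (\<forall>Q. fully_normalised F Q \<longrightarrow>
        (\<forall>\<chi>\<in>mor F Q Q.
           (\<forall>a\<in>Q. \<chi> (inv\<^bsub>base F\<^esub> a) \<otimes>\<^bsub>base F\<^esub> a \<otimes>\<^bsub>base F\<^esub> \<chi> (inv\<^bsub>base F\<^esub> a)
                    \<otimes>\<^bsub>base F\<^esub> \<chi> (\<chi> a) = \<one>\<^bsub>base F\<^esub>) \<longrightarrow>
           \<chi> \<in> p_core p (Aut_fs F Q)))"

end

(* The fusion system F of G = (F_p)^2 : SL_2(p) on a Sylow p-subgroup P is saturated, by Sylow's
   theorem.  Let V be the group of translations.  It is normal in G, so V is normal in F; and P/V has
   order p, so P/V is normal in F/V: the chain 1 < V < P shows that F is soluble.  A transvection t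
   acts quadratically on V, but O_p(Aut_F(V)) = O_p(SL_2(p)) = 1, because the upper and the lower
   unitriangular subgroups are Sylow p-subgroups which meet trivially.  So F is not p-stable. *)

theory Submission
  imports Defs "HOL-Algebra.Sylow" "HOL-Algebra.Zassenhaus" "HOL-Library.Countable"
begin

section \<open>Conjugation and Sylow subgroups\<close>

text \<open>Saturation is the laborious step, and its crux is the extension axiom. A morphism \<phi>
  from Q onto R is conjugation by some g, which may be changed by any element of C_G(R) without
  changing \<phi>; an extension exists once this freedom is used to carry the extension domain into
  P. Sylow's theorem does so inside N_P(R) C_G(R), where N_P(R) is a Sylow subgroup because R is
  fully normalised. For solubility, the morphisms of a quotient F/K have to be extended, but an
  extension need only be correct modulo K; this is what makes the top factor P/V easy. The stability
  condition, written additively on the abelian group V, reads (\<chi> - 1)^2 = 0, and a transvection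
  satisfies it. The affine maps are represented by numerical codes because the witness has to live
  on the natural numbers. P is recognised as the stabiliser of a translation, which shows that it is
  a subgroup and, through the length of the orbit, that its index is p^2 - 1.\<close>

definition conj_by :: "('a, 'b) monoid_scheme \<Rightarrow> 'a \<Rightarrow> 'a \<Rightarrow> 'a" where
  "conj_by G g u = g \<otimes>\<^bsub>G\<^esub> u \<otimes>\<^bsub>G\<^esub> inv\<^bsub>G\<^esub> g"

context group
begin

lemma conj_by_closed [simp]:
  "g \<in> carrier G \<Longrightarrow> u \<in> carrier G \<Longrightarrow> conj_by G g u \<in> carrier G"
  by (simp add: conj_by_def)

lemma conj_by_one [simp]: "u \<in> carrier G \<Longrightarrow> conj_by G \<one> u = u"
  by (simp add: conj_by_def)

lemma conj_by_mult:
  "g \<in> carrier G \<Longrightarrow> h \<in> carrier G \<Longrightarrow> u \<in> carrier G \<Longrightarrow>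
    conj_by G (g \<otimes> h) u = conj_by G g (conj_by G h u)"
  by (simp add: conj_by_def m_assoc inv_mult_group)

lemma conj_by_hom:
  "g \<in> carrier G \<Longrightarrow> u \<in> carrier G \<Longrightarrow> v \<in> carrier G \<Longrightarrow>
    conj_by G g (u \<otimes> v) = conj_by G g u \<otimes> conj_by G g v"
  by (simp add: conj_by_def m_assoc) (simp flip: m_assoc)

lemma conj_by_inv_cancel [simp]:
  assumes "g \<in> carrier G" "u \<in> carrier G"
  shows "conj_by G (inv g) (conj_by G g u) = u" "conj_by G g (conj_by G (inv g) u) = u"
  using assms by (simp_all flip: conj_by_mult)

lemma inj_on_conj_by:
  assumes "g \<in> carrier G" "Q \<subseteq> carrier G" shows "inj_on (conj_by G g) Q"
  using assms by (metis conj_by_inv_cancel(1) inj_on_inverseI subsetD)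

lemma conj_by_inv:
  "g \<in> carrier G \<Longrightarrow> u \<in> carrier G \<Longrightarrow> conj_by G g (inv u) = inv (conj_by G g u)"
  by (simp add: conj_by_def m_assoc inv_mult_group)

text \<open>The inverse in a restricted group is computed from its own carrier, and the base of the
  fusion system is such a restriction; this lets every conjugation be computed in G.\<close>

lemma conj_by_consistent:
  assumes "subgroup H G" "g \<in> H"
  shows "conj_by (G\<lparr>carrier := H\<rparr>) g = conj_by G g"
  using assms by (simp add: conj_by_def fun_eq_iff m_inv_consistent)

lemma conj_by_image_mult:
  assumes "g \<in> carrier G" "h \<in> carrier G" "Q \<subseteq> carrier G"
  shows "conj_by G (g \<otimes> h) ` Q = conj_by G g ` (conj_by G h ` Q)"
  unfolding image_image using assms by (intro image_cong) (auto simp: conj_by_mult)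

lemma conj_by_image_inv:
  assumes "g \<in> carrier G" "Q \<subseteq> carrier G"
  shows "conj_by G (inv g) ` (conj_by G g ` Q) = Q"
  unfolding image_image using assms by (simp add: subset_iff)

lemma conj_by_image_inv':
  assumes "g \<in> carrier G" "Q \<subseteq> carrier G"
  shows "conj_by G g ` (conj_by G (inv g) ` Q) = Q"
  unfolding image_image using assms by (simp add: subset_iff)

lemma subgroup_conj_image:
  assumes "g \<in> carrier G" "subgroup H G" shows "subgroup (conj_by G g ` H) G"
proof (rule subgroupI)
  note H = subgroup.subset[OF assms(2)]
  show "conj_by G g ` H \<subseteq> carrier G" using assms H by auto
  show "conj_by G g ` H \<noteq> {}" using subgroup.one_closed[OF assms(2)] by auto
  fix a assume "a \<in> conj_by G g ` H"
  then obtain x where x: "x \<in> H" "a = conj_by G g x" by auto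
  show "inv a \<in> conj_by G g ` H"
    proof -
    have "inv a = conj_by G g (inv x)" using x assms H by (simp add: conj_by_inv subset_iff)
    then show ?thesis using subgroup.m_inv_closed[OF assms(2) x(1)] by simp
  qed
  fix b assume "b \<in> conj_by G g ` H"
  then obtain y where y: "y \<in> H" "b = conj_by G g y" by auto
  show "a \<otimes> b \<in> conj_by G g ` H"
  proof -
    have "a \<otimes> b = conj_by G g (x \<otimes> y)" using x y assms H by (simp add: conj_by_hom subset_iff)
    then show ?thesis using subgroup.m_closed[OF assms(2) x(1) y(1)] by simp
  qed
qed

lemma card_subgroup_dvd: "subgroup H G \<Longrightarrow> card H dvd order G"
  using dvd_triv_right[of "card H" "card (rcosets H)"] by (simp only: lagrange)

lemma subgroup_restrict_iff:
  assumes "subgroup P G"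
  shows "subgroup Q (G\<lparr>carrier := P\<rparr>) \<longleftrightarrow> subgroup Q G \<and> Q \<subseteq> P"
  using assms incl_subgroup subgroup_incl
  by (metis partial_object.select_convs(1) partial_object.surjective partial_object.update_convs(1) subgroup.subset)

lemma normalizer_eq:
  assumes "H \<subseteq> carrier G"
  shows "normalizer G H = {g \<in> carrier G. conj_by G g ` H = H}"
proof -
  have "g <# H #> inv g = conj_by G g ` H" for g
    by (auto simp: l_coset_def r_coset_def conj_by_def)
  with assms show ?thesis by (simp add: normalizer_def stabilizer_def)
qed

lemma normalizer_restrict_eq:
  assumes "subgroup P G" "H \<subseteq> P"
  shows "normalizer (G\<lparr>carrier := P\<rparr>) H = {g \<in> P. conj_by G g ` H = H}"
proof -
  interpret P: group "G\<lparr>carrier := P\<rparr>" using assms(1) by (rule subgroup_imp_group)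
  show ?thesis using assms P.normalizer_eq[of H] by (auto simp: conj_by_consistent)
qed

lemma normalizer_restrict_subgroup:
  assumes "subgroup P G" "H \<subseteq> P"
  shows "subgroup (normalizer (G\<lparr>carrier := P\<rparr>) H) G"
proof -
  interpret P: group "G\<lparr>carrier := P\<rparr>" using assms(1) by (rule subgroup_imp_group)
  show ?thesis using P.normalizer_imp_subgroup[of H] assms
    by (simp add: subgroup_restrict_iff)
qed

lemma normal_iff_conj_image:
  "N \<lhd> G \<longleftrightarrow> subgroup N G \<and> (\<forall>g\<in>carrier G. conj_by G g ` N = N)"
proof
  assume N: "N \<lhd> G"
  then interpret normal N G .
  have "conj_by G g ` N \<subseteq> N" if "g \<in> carrier G" for g
    using that by (auto simp: conj_by_def inv_op_closed2)
  then show "subgroup N G \<and> (\<forall>g\<in>carrier G. conj_by G g ` N = N)"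
    using subgroup_axioms subset conj_by_image_inv'
    by (metis image_mono inv_closed subset_antisym)
next
  assume "subgroup N G \<and> (\<forall>g\<in>carrier G. conj_by G g ` N = N)"
  then show "N \<lhd> G"
    by (auto simp: normal_inv_iff conj_by_def[abs_def])
qed

end

lemma conj_maps_eq:
  "conj_maps G Q R =
    {restrict (conj_by G g) Q | g. g \<in> carrier G \<and> conj_by G g ` Q \<subseteq> R}"
  unfolding conj_maps_def conj_by_def[abs_def] image_subset_iff by simp

section \<open>Conjugacy in Sylow's theorem, by fixed points of p-groups\<close>

text \<open>Orbit lengths divide p^n, so without a fixed point each of them, and hence their sum,
  would be divisible by p.\<close>

lemma (in group_action) p_group_fixed_point:
  assumes "Factorial_Ring.prime (p::nat)" "order G = p ^ n" "finite E" "\<not> p dvd card E"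
  shows "\<exists>x\<in>E. \<forall>g\<in>carrier G. \<phi> g x = x"
proof (rule ccontr)
  assume no: "\<not> ?thesis"
  have "p dvd card orb" if orb: "orb \<in> orbits G E \<phi>" for orb
  proof -
    obtain x where x: "x \<in> E" "orb = orbit G \<phi> x" using orb by (auto simp: orbits_def)
    have "card orb dvd p ^ n"
      using dvd_triv_left[of "card orb" "card (stabilizer G \<phi> x)"]
      unfolding x(2) orbit_stabilizer_theorem[OF x(1)] assms(2) .
    then obtain j where j: "card orb = p ^ j"
      using divides_primepow_nat[OF assms(1)] by blast
    have "j \<noteq> 0"
    proof
      assume "j = 0"
      then have "card orb = 1" using j by simp
      then obtain y where y: "orb = {y}" by (auto simp: card_1_singleton_iff)
      have "y = x" using orbit_refl[OF x(1)] x(2) y by auto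
      have "\<phi> g x = x" if "g \<in> carrier G" for g
      proof -
        have "\<phi> g x \<in> orb" using that x(2) by (auto simp: orbit_def)
        with y \<open>y = x\<close> show ?thesis by simp
      qed
      with no x(1) show False by blast
    qed
    with j show ?thesis by simp
  qed
  then have "p dvd (\<Sum>orb\<in>orbits G E \<phi>. card orb)" by (rule dvd_sum)
  also have "\<dots> = card E"
    using disjoint_sum[OF assms(3), of "\<lambda>_. 1::nat"] by simp
  finally show False using assms(4) by contradiction
qed

context group
begin

text \<open>The inverse turns right multiplication on right cosets into a left action.\<close>

lemma rcosets_action:
  assumes "subgroup S G"
  shows "group_action G (rcosets S) (\<lambda>g. \<lambda>X\<in>rcosets S. X #> inv g)"
proof -
  let ?\<phi> = "\<lambda>g. \<lambda>X\<in>rcosets S. X #> inv g"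
  have S: "S \<subseteq> carrier G" using assms subgroup.subset by blast
  have sub: "X \<subseteq> carrier G" if "X \<in> rcosets S" for X
    using that assms by (simp add: subgroup.rcosets_carrier is_group)
  have cl: "X #> g \<in> rcosets S" if "X \<in> rcosets S" "g \<in> carrier G" for X g
    using that S by (auto simp: RCOSETS_def coset_mult_assoc)
  have bij: "?\<phi> g \<in> Bij (rcosets S)" if g: "g \<in> carrier G" for g
  proof -
    have "bij_betw (\<lambda>X. X #> inv g) (rcosets S) (rcosets S)"
      by (rule bij_betw_byWitness[where f' = "\<lambda>X. X #> g"])
         (use g sub cl in \<open>auto simp: coset_mult_assoc\<close>)
    then show ?thesis by (simp add: Bij_def bij_betw_restrict_eq)
  qed
  have "?\<phi> \<in> hom G (BijGroup (rcosets S))"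
    unfolding hom_def
  proof (intro CollectI conjI ballI funcsetI)
    fix g h assume gh: "g \<in> carrier G" "h \<in> carrier G"
    show "?\<phi> (g \<otimes> h) = ?\<phi> g \<otimes>\<^bsub>BijGroup (rcosets S)\<^esub> ?\<phi> h"
      using gh bij[of g] bij[of h]
      by (auto simp: BijGroup_def compose_def fun_eq_iff coset_mult_assoc sub cl inv_mult_group)
  qed (use bij in \<open>simp add: BijGroup_def\<close>)
  then show ?thesis
    by (simp add: group_action_def group_hom_def group_hom_axioms_def group_BijGroup)
qed

text \<open>H acts on the right cosets of S, whose number m is prime to p, so some coset Sg is
  fixed. From S g h^-1 = S g for all h in H it follows that g H g^-1 lies in S.\<close>

lemma p_subgroup_conj_into:
  assumes "Factorial_Ring.prime (p::nat)" "finite (carrier G)"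
    and S: "subgroup S G" and H: "subgroup H G" "card H = p ^ n"
    and "order G = card S * m" "\<not> p dvd m"
  shows "\<exists>g\<in>carrier G. conj_by G g ` H \<subseteq> S"
proof -
  interpret A: group_action "G\<lparr>carrier := H\<rparr>" "rcosets S" "\<lambda>g. \<lambda>X\<in>rcosets S. X #> inv g"
    using group_action.induced_action[OF rcosets_action[OF S] H(1)] .
  have Ssub: "S \<subseteq> carrier G" using S subgroup.subset by blast
  have Hsub: "H \<subseteq> carrier G" using H subgroup.subset by blast
  have "card (rcosets S) * card S = order G" using lagrange[OF S] .
  moreover have "card S > 0"
    using S assms(2) by (metis Ssub card_gt_0_iff empty_iff finite_subset subgroup.one_closed)
  ultimately have "card (rcosets S) = m" using assms(6) by (simp add: mult.commute)
  moreover have "finite (rcosets S)"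
    using assms(2) by (simp add: RCOSETS_def)
  ultimately obtain X where X: "X \<in> rcosets S" "\<forall>h\<in>H. X #> inv h = X"
    using A.p_group_fixed_point[OF assms(1), of n] assms(7) H(2) by (auto simp: order_def)
  then obtain g where g: "g \<in> carrier G" "X = S #> g" by (auto simp: RCOSETS_def)
  have "conj_by G g h \<in> S" if h: "h \<in> H" for h
  proof -
    have hc: "h \<in> carrier G" using h Hsub by auto
    have "S #> (g \<otimes> inv h) = S #> g"
      using X(2)[rule_format, OF h] g hc Ssub by (simp add: coset_mult_assoc)
    then have "S #> (g \<otimes> inv h \<otimes> inv g) = S"
      using coset_mult_inv2 g hc Ssub by simp
    then have "g \<otimes> inv h \<otimes> inv g \<in> S"
      using coset_join1[OF _ _ S] g hc by simp
    then have "inv (conj_by G g h) \<in> S"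
      using g hc by (simp add: conj_by_def inv_mult_group m_assoc)
    then show ?thesis
      using S g hc by (metis conj_by_closed inv_inv subgroup.m_inv_closed)
  qed
  with g show ?thesis by auto
qed

end

section \<open>Auxiliary facts on conjugation, products and images of Sylow subgroups\<close>

lemma (in group) conj_by_image_self:
  assumes "subgroup H G" "x \<in> H" shows "conj_by G x ` H = H"
proof -
  interpret H: group "G\<lparr>carrier := H\<rparr>" using assms(1) by (rule subgroup_imp_group)
  have sub: "conj_by G y ` H \<subseteq> H" if "y \<in> H" for y
    using that H.conj_by_closed[of y] assms(1) by (auto simp: conj_by_consistent)
  have "H = conj_by G x ` (conj_by G (inv x) ` H)"
    using assms conj_by_image_inv' subgroup.subset subgroup.mem_carrier by metis
  also have "\<dots> \<subseteq> conj_by G x ` H"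
    using sub[OF subgroup.m_inv_closed[OF assms]] by (rule image_mono)
  finally show ?thesis using sub[OF assms(2)] by blast
qed

text \<open>This is K C_G(R), described by its action on R: an element belongs to it when it acts on
  R as some element of K does. As K maps R to itself, such agreements can be composed and
  inverted.\<close>

lemma (in group) agreement_subgroup:
  assumes K: "subgroup K G" and R: "R \<subseteq> carrier G" and stab: "\<And>y. y \<in> K \<Longrightarrow> conj_by G y ` R = R"
  shows "subgroup {n \<in> carrier G. \<exists>y\<in>K. \<forall>r\<in>R. conj_by G n r = conj_by G y r} G" (is "subgroup ?M G")
proof (rule subgroupI)
  have Kc: "y \<in> carrier G" if "y \<in> K" for y using subgroup.mem_carrier[OF K that] .
  have Rc: "r \<in> carrier G" if "r \<in> R" for r using R that by blast
  have st: "conj_by G y r \<in> R" if "y \<in> K" "r \<in> R" for y r using stab[OF that(1)] that(2) by blast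
  show "?M \<subseteq> carrier G" by blast
  have "\<one> \<in> ?M" using subgroup.one_closed[OF K] by auto
  then show "?M \<noteq> {}" by blast
  fix a assume "a \<in> ?M"
  then obtain y where a: "a \<in> carrier G" "y \<in> K" "\<And>r. r \<in> R \<Longrightarrow> conj_by G a r = conj_by G y r"
    by blast
  have "conj_by G (inv a) r = conj_by G (inv y) r" if r: "r \<in> R" for r
  proof -
    have y': "inv y \<in> K" using subgroup.m_inv_closed[OF K a(2)] .
    have "conj_by G a (conj_by G (inv y) r) = conj_by G y (conj_by G (inv y) r)"
      using a(3) st[OF y' r] .
    also have "\<dots> = r" using Kc[OF a(2)] Rc[OF r] by simp
    finally have "conj_by G (inv a) r = conj_by G (inv a) (conj_by G a (conj_by G (inv y) r))" by simp
    then show ?thesis using a(1) Kc[OF y'] Rc[OF r] by simp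
  qed
  then show "inv a \<in> ?M" using a(1) subgroup.m_inv_closed[OF K a(2)] by blast
  fix b assume "b \<in> ?M"
  then obtain z where b: "b \<in> carrier G" "z \<in> K" "\<And>r. r \<in> R \<Longrightarrow> conj_by G b r = conj_by G z r"
    by blast
  have "conj_by G (a \<otimes> b) r = conj_by G (y \<otimes> z) r" if r: "r \<in> R" for r
    using a(3)[OF st[OF b(2) r]] b(3)[OF r] a(1) b(1) Kc[OF a(2)] Kc[OF b(2)] Rc[OF r]
    by (simp add: conj_by_mult)
  then show "a \<otimes> b \<in> ?M" using a(1) b(1) subgroup.m_closed[OF K a(2) b(2)] by blast
qed

text \<open>This makes taking images under conjugation a well-defined map on the cosets of K, the
  form in which morphisms of the quotient system are built later.\<close>

lemma (in group) conj_by_image_r_coset: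
  assumes "K \<lhd> G" "g \<in> carrier G" "x \<in> carrier G"
  shows "conj_by G g ` (K #> x) = K #> conj_by G g x"
proof -
  have K: "subgroup K G" "conj_by G g ` K = K" using assms by (auto simp: normal_iff_conj_image)
  have Kc: "u \<in> carrier G" if "u \<in> K" for u using subgroup.mem_carrier[OF K(1) that] .
  have "conj_by G g ` (K #> x) = (\<lambda>u. conj_by G g (u \<otimes> x)) ` K"
    by (auto simp: r_coset_def)
  also have "\<dots> = (\<lambda>u. conj_by G g u \<otimes> conj_by G g x) ` K"
    using assms Kc by (intro image_cong) (auto simp: conj_by_hom)
  also have "\<dots> = (\<lambda>u. u \<otimes> conj_by G g x) ` (conj_by G g ` K)" by (simp add: image_image)
  also have "\<dots> = K #> conj_by G g x" unfolding K(2) by (auto simp: r_coset_def)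
  finally show ?thesis .
qed

lemma (in group) subset_set_mult_left:
  assumes "T \<subseteq> carrier G" "subgroup L G" shows "T \<subseteq> T <#> L"
proof
  fix x assume x: "x \<in> T"
  then have "x \<otimes> \<one> \<in> T <#> L" using subgroup.one_closed[OF assms(2)] by (auto simp: set_mult_def)
  then show "x \<in> T <#> L" using x assms(1) by (simp add: subset_iff)
qed

lemma (in group) subset_set_mult_right:
  assumes "subgroup T G" "L \<subseteq> carrier G" shows "L \<subseteq> T <#> L"
proof
  fix x assume x: "x \<in> L"
  then have "\<one> \<otimes> x \<in> T <#> L" using subgroup.one_closed[OF assms(1)] by (auto simp: set_mult_def)
  then show "x \<in> T <#> L" using x assms(2) by (simp add: subset_iff)
qed

lemma (in group) subgroup_set_mult_normal:
  assumes "subgroup H G" "N \<lhd> G" shows "subgroup (H <#> N) G"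
  using commut_normal[OF assms] mult_norm_subgroup[OF assms(2,1)] by simp

lemma (in group_hom) order_eq_image_kernel:
  shows "order G = card (h ` carrier G) * card (kernel G H h)"
proof -
  let ?I = "H\<lparr>carrier := h ` carrier G\<rparr>"
  have gI: "group_hom G ?I h"
    using H.subgroup_imp_group[OF img_is_subgroup] G.is_group hom_mult
    by (auto simp: group_hom_def group_hom_axioms_def hom_def)
  have k: "kernel G ?I h = kernel G H h" by (simp add: kernel_def)
  have "G Mod kernel G ?I h \<cong> ?I"
    by (rule group_hom.FactGroup_iso[OF gI]) simp
  from iso_same_card[OF this] have "card (rcosets\<^bsub>G\<^esub> kernel G H h) = card (h ` carrier G)"
    unfolding k by (simp add: FactGroup_def)
  with G.lagrange[OF subgroup_kernel] show ?thesis by simp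
qed

lemma (in group_hom) sylow_image:
  assumes "Factorial_Ring.prime (p::nat)" "finite (carrier G)" "h ` carrier G = carrier H"
    and S: "subgroup S G" "card S = p ^ k" and m: "order G = card S * m" "\<not> p dvd m"
  shows "\<exists>j m'. subgroup (h ` S) H \<and> card (h ` S) = p ^ j \<and> order H = card (h ` S) * m' \<and> \<not> p dvd m'"
proof -
  have sub: "subgroup (h ` S) H" using S(1) by (rule subgroup_img_is_subgroup)
  interpret S: group_hom "G\<lparr>carrier := S\<rparr>" H h
    using S(1) by (rule induced_group_hom')
  have c1: "order G = order H * card (kernel G H h)"
    using order_eq_image_kernel assms(3) by (simp add: order_def)
  have c2: "card S = card (h ` S) * card (kernel (G\<lparr>carrier := S\<rparr>) H h)"
    using S.order_eq_image_kernel by (simp add: order_def)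
  let ?K = "kernel (G\<lparr>carrier := S\<rparr>) H h"
  have K: "?K = kernel G H h \<inter> S"
    using S(1) subgroup.subset by (auto simp: kernel_def)
  have "subgroup ?K (G\<lparr>carrier := kernel G H h\<rparr>)"
    unfolding K using S(1) subgroup_kernel
    by (simp add: G.subgroup_restrict_iff G.subgroups_Inter_pair)
  then have "card ?K dvd card (kernel G H h)"
    using group.card_subgroup_dvd[OF G.subgroup_imp_group[OF subgroup_kernel]]
    by (simp add: order_def)
  then obtain b where b: "card (kernel G H h) = card ?K * b" by auto
  obtain a where a: "order H = card (h ` S) * a"
    using H.lagrange[OF sub] by (metis mult.commute)
  have "card S > 0" using S(2) assms(1) prime_gt_0_nat by simp
  have "card S * m = card S * (a * b)"
    using m(1) c1 c2 unfolding a b by auto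
  then have "m = a * b" using \<open>card S > 0\<close> by simp
  then have "\<not> p dvd a" using m(2) by auto
  moreover have "card (h ` S) dvd p ^ k" using c2 S(2) by simp
  then obtain j where "card (h ` S) = p ^ j"
    using divides_primepow_nat[OF assms(1)] by blast
  ultimately show ?thesis using sub a by blast
qed

section \<open>The fusion system of a finite group\<close>

text \<open>Conjugating elements range over all of G although the base is only P. The case
  distinction empties the morphism sets between sets that are not subgroups of P, as
  \<open>fusion_on\<close> demands.\<close>

definition group_fs :: "'a monoid \<Rightarrow> 'a set \<Rightarrow> 'a fusion_system" where
  "group_fs G P =
     \<lparr>base = G\<lparr>carrier := P\<rparr>,
      mor = (\<lambda>Q R. if subgroup Q (G\<lparr>carrier := P\<rparr>) \<and> subgroup R (G\<lparr>carrier := P\<rparr>)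
                    then conj_maps G Q R else {})\<rparr>"

lemma base_group_fs [simp]: "base (group_fs G P) = G\<lparr>carrier := P\<rparr>"
  by (simp add: group_fs_def)

text \<open>The Sylow property is given as a p-power order with a cofactor prime to p, the form in
  which the conjugacy result consumes it.\<close>

locale sylow_pair = group G for G :: "'a monoid" (structure) +
  fixes p :: nat and P :: "'a set"
  assumes p_prime: "Factorial_Ring.prime p"
    and fin: "finite (carrier G)"
    and P_subgroup: "subgroup P G"
    and P_card: "\<exists>k. card P = p ^ k"
    and P_index: "\<exists>m. order G = card P * m \<and> \<not> p dvd m"
begin

abbreviation F where "F \<equiv> group_fs G P"

lemma P_sub: "P \<subseteq> carrier G" using P_subgroup by (rule subgroup.subset)

lemma finite_sub: "Q \<subseteq> carrier G \<Longrightarrow> finite Q" using fin by (rule rev_finite_subset)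

lemma mor_iff:
  "\<phi> \<in> mor F Q R \<longleftrightarrow> subgroup Q G \<and> subgroup R G \<and> Q \<subseteq> P \<and> R \<subseteq> P \<and>
    (\<exists>g\<in>carrier G. conj_by G g ` Q \<subseteq> R \<and> \<phi> = restrict (conj_by G g) Q)"
  using P_subgroup by (auto simp: group_fs_def conj_maps_eq subgroup_restrict_iff)

lemma morI:
  "subgroup Q G \<Longrightarrow> subgroup R G \<Longrightarrow> Q \<subseteq> P \<Longrightarrow> R \<subseteq> P \<Longrightarrow> g \<in> carrier G \<Longrightarrow>
    conj_by G g ` Q \<subseteq> R \<Longrightarrow> restrict (conj_by G g) Q \<in> mor F Q R"
  by (auto simp: mor_iff)

lemma p_subgroup_card:
  assumes "subgroup H G" "card H = p ^ k" "subgroup K G" "K \<subseteq> H"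
  shows "\<exists>j. card K = p ^ j"
proof -
  have "group (G\<lparr>carrier := H\<rparr>)" using assms(1) by (rule subgroup_imp_group)
  then have "card K dvd order (G\<lparr>carrier := H\<rparr>)"
    using assms by (intro group.card_subgroup_dvd) (simp_all add: subgroup_restrict_iff)
  then have "card K dvd p ^ k" using assms(2) by (simp add: order_def)
  then show ?thesis using divides_primepow_nat[OF p_prime] by blast
qed

lemma fusion_on_group_fs: "fusion_on p F"
  unfolding fusion_on_def base_group_fs
proof (intro conjI)
  show "finite_p_group p (G\<lparr>carrier := P\<rparr>)"
    using P_card finite_sub[OF P_sub] subgroup_imp_group[OF P_subgroup]
    by (simp add: finite_p_group_def order_def)
next
  show "\<forall>Q R. \<forall>\<phi>\<in>mor F Q R.
        subgroup Q (G\<lparr>carrier := P\<rparr>) \<and> subgroup R (G\<lparr>carrier := P\<rparr>) \<and>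
        \<phi> \<in> extensional Q \<and> inj_on \<phi> Q \<and>
        \<phi> \<in> hom (G\<lparr>carrier := P\<rparr>\<lparr>carrier := Q\<rparr>) (G\<lparr>carrier := P\<rparr>\<lparr>carrier := R\<rparr>)"
  proof (intro allI ballI)
    fix Q R \<phi> assume "\<phi> \<in> mor F Q R"
    then obtain g where *: "subgroup Q G" "subgroup R G" "Q \<subseteq> P" "R \<subseteq> P" "g \<in> carrier G"
      "conj_by G g ` Q \<subseteq> R" "\<phi> = restrict (conj_by G g) Q"
      unfolding mor_iff by blast
    have Q: "u \<in> carrier G" if "u \<in> Q" for u using subgroup.mem_carrier[OF *(1) that] .
    have "inj_on (conj_by G g) Q" using *(5) Q by (auto intro: inj_on_conj_by)
    moreover have "conj_by G g (x \<otimes> y) = conj_by G g x \<otimes> conj_by G g y" if "x \<in> Q" "y \<in> Q" for x y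
      using that Q *(5) by (simp add: conj_by_hom)
    moreover have "conj_by G g x \<in> R" if "x \<in> Q" for x using that *(6) by blast
    ultimately show "subgroup Q (G\<lparr>carrier := P\<rparr>) \<and> subgroup R (G\<lparr>carrier := P\<rparr>) \<and>
        \<phi> \<in> extensional Q \<and> inj_on \<phi> Q \<and>
        \<phi> \<in> hom (G\<lparr>carrier := P\<rparr>\<lparr>carrier := Q\<rparr>) (G\<lparr>carrier := P\<rparr>\<lparr>carrier := R\<rparr>)"
      using * P_subgroup subgroup.m_closed[OF *(1)]
      by (simp add: subgroup_restrict_iff inj_on_restrict_eq hom_def)
  qed
next
  show "\<forall>Q R. subgroup Q (G\<lparr>carrier := P\<rparr>) \<longrightarrow> subgroup R (G\<lparr>carrier := P\<rparr>) \<longrightarrow>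
        conj_maps (G\<lparr>carrier := P\<rparr>) Q R \<subseteq> mor F Q R"
    using P_subgroup P_sub
    by (auto simp: group_fs_def conj_maps_eq conj_by_consistent) blast
next
  show "\<forall>Q R S. \<forall>\<phi>\<in>mor F Q R. \<forall>\<psi>\<in>mor F R S. compose Q \<psi> \<phi> \<in> mor F Q S"
  proof (intro allI ballI)
    fix Q R S \<phi> \<psi> assume "\<phi> \<in> mor F Q R" "\<psi> \<in> mor F R S"
    then obtain g h where *: "subgroup Q G" "subgroup R G" "subgroup S G" "Q \<subseteq> P" "R \<subseteq> P" "S \<subseteq> P"
      "g \<in> carrier G" "conj_by G g ` Q \<subseteq> R" "\<phi> = restrict (conj_by G g) Q"
      "h \<in> carrier G" "conj_by G h ` R \<subseteq> S" "\<psi> = restrict (conj_by G h) R"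
      unfolding mor_iff by blast
    have Q: "u \<in> carrier G" if "u \<in> Q" for u using subgroup.mem_carrier[OF *(1) that] .
    have R: "conj_by G g u \<in> R" if "u \<in> Q" for u using that *(8) by blast
    have "compose Q \<psi> \<phi> = restrict (conj_by G (h \<otimes> g)) Q"
      using *(7-12) Q R by (auto simp: compose_def conj_by_mult fun_eq_iff)
    moreover have "conj_by G (h \<otimes> g) ` Q \<subseteq> S"
      using conj_by_image_mult[OF *(10,7) subgroup.subset[OF *(1)]] image_mono[OF *(8), of "conj_by G h"] *(11)
      by simp
    ultimately show "compose Q \<psi> \<phi> \<in> mor F Q S" using * by (auto intro: morI)
  qed
next
  show "\<forall>Q R. \<forall>\<phi>\<in>mor F Q R.
        \<phi> \<in> mor F Q (\<phi> ` Q) \<and> restrict (inv_into Q \<phi>) (\<phi> ` Q) \<in> mor F (\<phi> ` Q) Q"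
  proof (intro allI ballI)
    fix Q R \<phi> assume "\<phi> \<in> mor F Q R"
    then obtain g where *: "subgroup Q G" "subgroup R G" "Q \<subseteq> P" "R \<subseteq> P" "g \<in> carrier G"
      "conj_by G g ` Q \<subseteq> R" and \<phi>: "\<phi> = restrict (conj_by G g) Q"
      unfolding mor_iff by blast
    have Q: "u \<in> carrier G" if "u \<in> Q" for u using subgroup.mem_carrier[OF *(1) that] .
    have inj: "inj_on \<phi> Q" using *(5) Q unfolding \<phi> inj_on_restrict_eq by (auto intro: inj_on_conj_by)
    have im: "\<phi> ` Q = conj_by G g ` Q" unfolding \<phi> by simp
    have sg: "subgroup (conj_by G g ` Q) G" using subgroup_conj_image *(5,1) .
    have 1: "\<phi> \<in> mor F Q (\<phi> ` Q)"
      unfolding im unfolding \<phi> using * sg by (intro morI) auto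
    have "inv_into Q \<phi> (\<phi> u) = conj_by G (inv g) (\<phi> u)" if "u \<in> Q" for u
      using that inj *(5) Q by (simp add: inv_into_f_f) (simp add: \<phi>)
    then have "restrict (inv_into Q \<phi>) (\<phi> ` Q) = restrict (conj_by G (inv g)) (\<phi> ` Q)"
      by (auto simp: fun_eq_iff)
    moreover have "restrict (conj_by G (inv g)) (\<phi> ` Q) \<in> mor F (\<phi> ` Q) Q"
      unfolding im using * sg conj_by_image_inv[OF *(5) subgroup.subset[OF *(1)]]
      by (intro morI) auto
    ultimately show "\<phi> \<in> mor F Q (\<phi> ` Q) \<and> restrict (inv_into Q \<phi>) (\<phi> ` Q) \<in> mor F (\<phi> ` Q) Q"
      using 1 by simp
  qed
qed

section \<open>Automorphism groups in F as images of normalisers\<close>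

text \<open>This is the identification of Aut_F(Q) with N_G(Q)/C_G(Q). It also supplies the fact
  that \<open>Aut_fs F Q\<close> is a group, being the image of a homomorphism into the symmetric
  group on Q.\<close>

lemma group_hom_Aut:
  assumes Q: "subgroup Q G" "Q \<subseteq> P"
  defines "h \<equiv> \<lambda>x. restrict (conj_by G x) Q"
  shows "group_hom (G\<lparr>carrier := normalizer G Q\<rparr>) (Aut_fs F Q) h"
    and "h ` normalizer G Q = carrier (Aut_fs F Q)"
proof -
  have Qc: "u \<in> carrier G" if "u \<in> Q" for u using subgroup.mem_carrier[OF Q(1) that] .
  have Qsub: "Q \<subseteq> carrier G" using Qc by blast
  note N = normalizer_eq[OF Qsub]
  have Ng: "subgroup (normalizer G Q) G" using normalizer_imp_subgroup[OF Qsub] .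
  have stab: "conj_by G x u \<in> Q" if "x \<in> normalizer G Q" "u \<in> Q" for x u
    using that unfolding N by blast
  have bij: "h x \<in> Bij Q" if "x \<in> normalizer G Q" for x
    using that inj_on_conj_by[OF _ Qsub, of x] unfolding N h_def
    by (simp add: Bij_def bij_betw_def inj_on_restrict_eq)
  have mult: "h (x \<otimes> y) = h x \<otimes>\<^bsub>BijGroup Q\<^esub> h y" if "x \<in> normalizer G Q" "y \<in> normalizer G Q" for x y
  proof -
    have "h (x \<otimes> y) = compose Q (h x) (h y)"
      using that stab[OF that(2)] Qc unfolding N h_def
      by (auto simp: compose_def fun_eq_iff conj_by_mult)
    then show ?thesis using bij that by (simp add: BijGroup_def)
  qed
  interpret hom: group_hom "G\<lparr>carrier := normalizer G Q\<rparr>" "BijGroup Q" h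
    using subgroup_imp_group[OF Ng] group_BijGroup[of Q] bij mult
    by (simp add: group_hom_def group_hom_axioms_def hom_def BijGroup_def)
  have im: "h ` normalizer G Q = mor F Q Q"
  proof
    show "h ` normalizer G Q \<subseteq> mor F Q Q"
      unfolding h_def N using Q by (auto intro!: morI)
    show "mor F Q Q \<subseteq> h ` normalizer G Q"
    proof
      fix \<phi> assume "\<phi> \<in> mor F Q Q"
      then obtain g where g: "g \<in> carrier G" "conj_by G g ` Q \<subseteq> Q" "\<phi> = h g"
        unfolding mor_iff h_def by blast
      \<comment> \<open>A morphism from Q to Q is only known to map into Q; injectivity and
        finiteness make it onto, so g normalises Q.\<close>
      have "conj_by G g ` Q = Q"
        using g(2) endo_inj_surj[OF finite_sub[OF Qsub] g(2) inj_on_conj_by[OF g(1) Qsub]] by blast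
      with g show "\<phi> \<in> h ` normalizer G Q" unfolding N by blast
    qed
  qed
  show "h ` normalizer G Q = carrier (Aut_fs F Q)"
    using im by (simp add: Aut_fs_def)
  have "subgroup (mor F Q Q) (BijGroup Q)"
    using hom.img_is_subgroup im by simp
  then have "group (Aut_fs F Q)"
    unfolding Aut_fs_def by (rule group.subgroup_imp_group[OF group_BijGroup])
  then show "group_hom (G\<lparr>carrier := normalizer G Q\<rparr>) (Aut_fs F Q) h"
    using subgroup_imp_group[OF Ng] mult im
    by (auto simp: group_hom_def group_hom_axioms_def hom_def Aut_fs_def)
qed

lemma index_in_between:
  assumes "subgroup M G" "subgroup K G" "K \<subseteq> M" "order G = card K * m" "\<not> p dvd m"
  shows "\<exists>m'. card M = card K * m' \<and> \<not> p dvd m'"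
proof -
  have "card K dvd card M"
    using group.card_subgroup_dvd[OF subgroup_imp_group[OF assms(1)], of K] assms(1-3)
    by (simp add: subgroup_restrict_iff order_def)
  then obtain m' where m': "card M = card K * m'" by blast
  have K0: "card K \<noteq> 0"
    using finite_sub[OF subgroup.subset[OF assms(2)]] subgroup.one_closed[OF assms(2)] by auto
  have "card M dvd order G" using assms(1) by (rule card_subgroup_dvd)
  then have "m' dvd m" using K0 m' assms(4) by simp
  then have "\<not> p dvd m'" using assms(5) dvd_trans by blast
  with m' show ?thesis by blast
qed

text \<open>P is a Sylow subgroup of G inside N_G(Q), hence one of N_G(Q), and Sylow subgroups
  survive the passage to the image Aut_F(Q). The case Q = P gives the first saturation axiom; Q = V
  serves for the p-core.\<close>

lemma sylow_Aut:
  assumes Q: "subgroup Q G" "Q \<subseteq> P" and PN: "P \<subseteq> normalizer G Q"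
  shows "\<exists>j m. subgroup ((\<lambda>x. restrict (conj_by G x) Q) ` P) (Aut_fs F Q) \<and>
    card ((\<lambda>x. restrict (conj_by G x) Q) ` P) = p ^ j \<and>
    order (Aut_fs F Q) = card ((\<lambda>x. restrict (conj_by G x) Q) ` P) * m \<and> \<not> p dvd m"
proof -
  let ?h = "\<lambda>x. restrict (conj_by G x) Q"
  let ?N = "normalizer G Q"
  interpret h: group_hom "G\<lparr>carrier := ?N\<rparr>" "Aut_fs F Q" ?h
    by (rule group_hom_Aut) (use Q in auto)
  have surj: "?h ` carrier (G\<lparr>carrier := ?N\<rparr>) = carrier (Aut_fs F Q)"
    using group_hom_Aut(2)[OF Q] by simp
  have Ng: "subgroup ?N G" using normalizer_imp_subgroup[OF subgroup.subset[OF Q(1)]] .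
  obtain k where k: "card P = p ^ k" using P_card by blast
  obtain m where m: "order G = card P * m" "\<not> p dvd m" using P_index by blast
  obtain m' where m': "card ?N = card P * m'" "\<not> p dvd m'"
    using index_in_between[OF Ng P_subgroup PN m] by blast
  have "finite ?N" using finite_sub[OF subgroup.subset[OF Ng]] .
  then show ?thesis
    using h.sylow_image[OF p_prime _ surj, of P k m'] m' k PN P_subgroup Ng
    by (simp add: order_def subgroup_restrict_iff)
qed

lemma sylow_Aut_base:
  "sylow_subgroup p (Aut_fs F P) (conj_maps (G\<lparr>carrier := P\<rparr>) P P)"
proof -
  let ?h = "\<lambda>x. restrict (conj_by G x) P"
  have "P \<subseteq> normalizer G P" using P_sub conj_by_image_self[OF P_subgroup] by (auto simp: normalizer_eq)
  then obtain j m where j: "subgroup (?h ` P) (Aut_fs F P)" "card (?h ` P) = p ^ j"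
      "order (Aut_fs F P) = card (?h ` P) * m" "\<not> p dvd m"
    using sylow_Aut[OF P_subgroup] by blast
  have "conj_maps (G\<lparr>carrier := P\<rparr>) P P = (\<lambda>g. restrict (conj_by (G\<lparr>carrier := P\<rparr>) g) P) ` P"
  proof -
    have "conj_by (G\<lparr>carrier := P\<rparr>) g ` P \<subseteq> P" if "g \<in> P" for g
      using that by (simp add: conj_by_consistent[OF P_subgroup] conj_by_image_self[OF P_subgroup])
    then show ?thesis unfolding conj_maps_eq by auto
  qed
  also have "\<dots> = ?h ` P"
    by (intro image_cong) (simp_all add: conj_by_consistent[OF P_subgroup])
  finally have "?h ` P = conj_maps (G\<lparr>carrier := P\<rparr>) P P" ..
  moreover have "multiplicity p (order (Aut_fs F P)) = j"
    using j(2-4) p_prime by (intro multiplicity_eqI) (auto simp: prime_gt_1_nat)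
  ultimately show ?thesis using j by (simp add: sylow_subgroup_def)
qed

section \<open>Fully normalised subgroups and the extension axiom\<close>

text \<open>N_P(R) is a Sylow subgroup of N_G(R). A Sylow subgroup S of N_G(R) is conjugate under
  some g to a subgroup of P, which normalises g R g^-1. Hence |S| is at most the order of N_P(g R
  g^-1), which is at most |N_P(R)| because R is fully normalised.\<close>

lemma fully_normalised_sylow:
  assumes "fully_normalised F R"
  defines "N \<equiv> normalizer (G\<lparr>carrier := P\<rparr>) R"
  shows "\<exists>m. card (normalizer G R) = card N * m \<and> \<not> p dvd m"
proof -
  have R: "subgroup R G" "R \<subseteq> P"
    using assms P_subgroup by (auto simp: fully_normalised_def subgroup_restrict_iff)
  have full: "card (normalizer (G\<lparr>carrier := P\<rparr>) (\<phi> ` R)) \<le> card N" if "\<phi> \<in> mor F R T" for \<phi> T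
    using that assms by (auto simp: fully_normalised_def)
  have Rsub: "R \<subseteq> carrier G" using R(1) by (rule subgroup.subset)
  have NP: "N = {g \<in> P. conj_by G g ` R = R}"
    unfolding N_def using normalizer_restrict_eq[OF P_subgroup R(2)] .
  have NG: "normalizer G R = {g \<in> carrier G. conj_by G g ` R = R}" using normalizer_eq[OF Rsub] .
  have sNP: "subgroup N G" unfolding N_def using normalizer_restrict_subgroup[OF P_subgroup R(2)] .
  have sNG: "subgroup (normalizer G R) G" using normalizer_imp_subgroup[OF Rsub] .
  interpret NG: group "G\<lparr>carrier := normalizer G R\<rparr>" using sNG by (rule subgroup_imp_group)
  have RNG: "R \<subseteq> normalizer G R" unfolding NG using conj_by_image_self[OF R(1)] Rsub by blast
  have fN: "finite (normalizer G R)" using finite_sub[OF subgroup.subset[OF sNG]] .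
  have NN: "N \<subseteq> normalizer G R" unfolding NP NG using P_sub by blast
  obtain k where k: "card P = p ^ k" using P_card by blast
  obtain b where b: "card N = p ^ b" using p_subgroup_card[OF P_subgroup k sNP] NP by blast
  obtain c where c: "card R = p ^ c" using p_subgroup_card[OF P_subgroup k R] by blast
  have cN: "card (normalizer G R) > 0" using fN sNG card_gt_0_iff subgroup.one_closed by blast
  then obtain a m where a: "card (normalizer G R) = p ^ a * m" "\<not> p dvd m"
    using multiplicity_decompose'[of "card (normalizer G R)" p] p_prime
    by (metis not_prime_unit not_gr_zero)
  have oN: "order (G\<lparr>carrier := normalizer G R\<rparr>) = p ^ a * m" using a by (simp add: order_def)
  obtain S where S: "subgroup S (G\<lparr>carrier := normalizer G R\<rparr>)" "card S = p ^ a"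
    using sylow_thm[OF p_prime NG.is_group oN] fN by auto
  then have SG: "subgroup S G" "S \<subseteq> normalizer G R" using sNG by (auto simp: subgroup_restrict_iff)
  \<comment> \<open>R is a p-subgroup of N_G(R), so a conjugate of it lies in S; the conjugating
    element normalises R, so R itself lies in S. This makes g R g^-1 a subgroup of P below, and
    conjugation by g a morphism of F.\<close>
  have "\<exists>n\<in>normalizer G R. conj_by G n ` R \<subseteq> S"
    using NG.p_subgroup_conj_into[OF p_prime _ S(1), of R c m] R RNG sNG c oN S(2) a(2) fN
    by (auto simp: subgroup_restrict_iff conj_by_consistent)
  then have RS: "R \<subseteq> S" unfolding NG by auto
  obtain m' where m': "order G = card P * m'" "\<not> p dvd m'" using P_index by blast
  obtain g where g: "g \<in> carrier G" "conj_by G g ` S \<subseteq> P"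
    using p_subgroup_conj_into[OF p_prime fin P_subgroup SG(1) S(2) m'] by blast
  let ?R = "conj_by G g ` R"
  have RP: "?R \<subseteq> P" using RS g(2) by blast
  have "restrict (conj_by G g) R \<in> mor F R P"
    using R P_subgroup g RP by (intro morI) auto
  from full[OF this] have le: "card (normalizer (G\<lparr>carrier := P\<rparr>) ?R) \<le> card N" by simp
  have "conj_by G g ` S \<subseteq> normalizer (G\<lparr>carrier := P\<rparr>) ?R"
  proof
    fix y assume "y \<in> conj_by G g ` S"
    then obtain s where s: "s \<in> S" "y = conj_by G g s" by blast
    have sc: "s \<in> carrier G" "conj_by G s ` R = R" using s(1) SG(2) unfolding NG by auto
    have "y = g \<otimes> s \<otimes> inv g" unfolding s(2) conj_by_def ..
    then have "conj_by G y ` ?R = conj_by G g ` (conj_by G s ` (conj_by G (inv g) ` ?R))"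
      using g(1) sc(1) Rsub subgroup.subset[OF subgroup_conj_image[OF g(1) R(1)]]
      by (simp add: conj_by_image_mult subgroup.subset[OF subgroup_conj_image[OF _ R(1)]] conj_by_image_inv)
    also have "\<dots> = ?R" using conj_by_image_inv[OF g(1) Rsub] sc(2) by simp
    finally have "conj_by G y ` ?R = ?R" .
    moreover have "y \<in> P" using s g(2) by blast
    ultimately show "y \<in> normalizer (G\<lparr>carrier := P\<rparr>) ?R"
      using normalizer_restrict_eq[OF P_subgroup RP] by blast
  qed
  moreover have "finite (normalizer (G\<lparr>carrier := P\<rparr>) ?R)"
    using normalizer_restrict_eq[OF P_subgroup RP] finite_sub[OF P_sub] by simp
  ultimately have "card (conj_by G g ` S) \<le> card N" using le card_mono le_trans by blast
  moreover have "card (conj_by G g ` S) = card S"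
    using inj_on_conj_by[OF g(1) subgroup.subset[OF SG(1)]] by (rule card_image)
  ultimately have "p ^ a \<le> p ^ b" using S(2) b by simp
  then have "a \<le> b" using p_prime prime_gt_1_nat power_le_imp_le_exp by blast
  have "card N dvd card (normalizer G R)"
    using NG.card_subgroup_dvd[of N] NN sNP sNG by (simp add: subgroup_restrict_iff order_def)
  then have "p ^ b dvd p ^ a * m" using b a by simp
  moreover have "coprime (p ^ b) m" using p_prime a(2) by (simp add: prime_imp_coprime)
  ultimately have "p ^ b dvd p ^ a" by (simp add: coprime_dvd_mult_left_iff)
  then have "b \<le> a" using p_prime prime_gt_1_nat power_dvd_imp_le by blast
  with \<open>a \<le> b\<close> show ?thesis using a b by auto
qed

text \<open>The extension sought is conjugation by an element h that agrees with g on Q and carries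
  the whole extension domain into P. Full normalisation enters only through the Sylow property of
  N_P(R).\<close>

lemma mor_extends:
  assumes \<phi>: "\<phi> \<in> mor F Q P" and full: "fully_normalised F (\<phi> ` Q)"
  shows "\<exists>\<psi>\<in>mor F (ext_dom F Q \<phi>) P. restrict \<psi> Q = \<phi>"
proof -
  obtain g where g: "subgroup Q G" "Q \<subseteq> P" "g \<in> carrier G" "conj_by G g ` Q \<subseteq> P"
    "\<phi> = restrict (conj_by G g) Q"
    using \<phi> unfolding mor_iff by blast
  define R where "R = conj_by G g ` Q"
  have \<phi>Q: "\<phi> ` Q = R" unfolding g(5) R_def by simp
  have RG: "subgroup R G" unfolding R_def using subgroup_conj_image[OF g(3,1)] .
  have RP: "R \<subseteq> P" unfolding R_def using g(4) .
  have Qsub: "Q \<subseteq> carrier G" and Rsub: "R \<subseteq> carrier G" using subgroup.subset g(1) RG by auto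
  define NQ NR where "NQ = normalizer (G\<lparr>carrier := P\<rparr>) Q" and "NR = normalizer (G\<lparr>carrier := P\<rparr>) R"
  have NQ: "NQ = {x \<in> P. conj_by G x ` Q = Q}" and NR: "NR = {x \<in> P. conj_by G x ` R = R}"
    unfolding NQ_def NR_def using normalizer_restrict_eq[OF P_subgroup] g(2) RP by auto
  have NQg: "subgroup NQ G" and NRg: "subgroup NR G"
    unfolding NQ_def NR_def using normalizer_restrict_subgroup[OF P_subgroup] g(2) RP by auto
  have NQc: "x \<in> carrier G" if "x \<in> NQ" for x using subgroup.mem_carrier[OF NQg that] .
  have NRc: "x \<in> carrier G" if "x \<in> NR" for x using subgroup.mem_carrier[OF NRg that] .
  \<comment> \<open>\<open>M = N\<^sub>P(R) C\<^sub>G(R)\<close>; Sylow's theorem in \<open>M\<close> moves the conjugate by \<open>g\<close> of the extension domain into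
    \<open>N\<^sub>P(R)\<close>, and the conjugating element may be corrected to centralise \<open>R\<close>.\<close>
  define M where "M = {n \<in> carrier G. \<exists>y\<in>NR. \<forall>r\<in>R. conj_by G n r = conj_by G y r}"
  have Mg: "subgroup M G" unfolding M_def
    by (rule agreement_subgroup[OF NRg Rsub]) (simp add: NR)
  have NRM: "NR \<subseteq> M" unfolding M_def using NRc by blast
  have MN: "M \<subseteq> normalizer G R"
  proof
    fix n assume "n \<in> M"
    then obtain y where y: "n \<in> carrier G" "y \<in> NR" "\<forall>r\<in>R. conj_by G n r = conj_by G y r"
      unfolding M_def by blast
    have "conj_by G n ` R = conj_by G y ` R" using y(3) by (intro image_cong) auto
    then show "n \<in> normalizer G R" using y unfolding normalizer_eq[OF Rsub] NR by simp
  qed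
  have gi: "inv g \<in> carrier G" using g(3) by simp
  \<comment> \<open>Because g x = (g x g^-1) g, applying \<phi> after conjugation by x is
    conjugation by g x g^-1 after \<phi>. So x in N_P(Q) lies in the extension domain exactly when g
    x g^-1 acts on R as an element of N_P(R), that is, lies in \<open>M\<close>.\<close>
  have D: "ext_dom F Q \<phi> = NQ \<inter> conj_by G (inv g) ` M" (is "?D = _")
  proof -
    have *: "(\<exists>y\<in>NR. \<forall>u\<in>Q. \<phi> (conj_by G x u) = conj_by G y (\<phi> u)) \<longleftrightarrow> conj_by G g x \<in> M"
      if x: "x \<in> NQ" for x
    proof -
      have xc: "x \<in> carrier G" using NQc[OF x] .
      have "\<phi> (conj_by G x u) = conj_by G (conj_by G g x) (\<phi> u)" if u: "u \<in> Q" for u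
      proof -
        have uc: "u \<in> carrier G" using u Qsub by blast
        have "conj_by G x u \<in> Q" using x u unfolding NQ by blast
        then have "\<phi> (conj_by G x u) = conj_by G (g \<otimes> x) u"
          using g(3) xc uc by (simp add: g(5) conj_by_mult)
        also have "g \<otimes> x = conj_by G g x \<otimes> g" using g(3) xc by (simp add: conj_by_def m_assoc)
        also have "conj_by G (conj_by G g x \<otimes> g) u = conj_by G (conj_by G g x) (conj_by G g u)"
          using g(3) xc uc by (simp add: conj_by_mult)
        finally show ?thesis using u by (simp add: g(5))
      qed
      then have "(\<forall>u\<in>Q. \<phi> (conj_by G x u) = conj_by G y (\<phi> u)) \<longleftrightarrow>
          (\<forall>r\<in>R. conj_by G (conj_by G g x) r = conj_by G y r)" for y
        unfolding \<phi>Q[symmetric] by simp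
      then show ?thesis using g(3) xc unfolding M_def by simp
    qed
    have "?D = {x \<in> NQ. \<exists>y\<in>NR. \<forall>u\<in>Q. \<phi> (conj_by G x u) = conj_by G y (\<phi> u)}"
      unfolding ext_dom_def base_group_fs \<phi>Q NQ_def[symmetric] NR_def[symmetric] 
      unfolding conj_by_def[symmetric]
      using conj_by_consistent[OF P_subgroup] unfolding NQ NR by (auto cong: conj_cong)
    also have "\<dots> = {x \<in> NQ. conj_by G g x \<in> M}" using * by blast
    also have "\<dots> = NQ \<inter> conj_by G (inv g) ` M"
    proof -
      have "conj_by G g x \<in> M \<longleftrightarrow> x \<in> conj_by G (inv g) ` M" if "x \<in> carrier G" for x
      proof
        assume "conj_by G g x \<in> M"
        then have "conj_by G (inv g) (conj_by G g x) \<in> conj_by G (inv g) ` M" by (rule imageI)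
        then show "x \<in> conj_by G (inv g) ` M" using g(3) that by simp
      next
        assume "x \<in> conj_by G (inv g) ` M"
        then show "conj_by G g x \<in> M" using g(3) subgroup.mem_carrier[OF Mg] by auto
      qed
      then show ?thesis using NQc by blast
    qed
    finally show ?thesis .
  qed
  have Dg: "subgroup ?D G"
    unfolding D by (intro subgroups_Inter_pair NQg subgroup_conj_image gi Mg)
  have DP: "?D \<subseteq> P" unfolding D NQ by blast
  have Dsub: "?D \<subseteq> carrier G" using subgroup.subset[OF Dg] .
  obtain k where k: "card P = p ^ k" using P_card by blast
  obtain d where d: "card ?D = p ^ d" using p_subgroup_card[OF P_subgroup k Dg DP] by blast
  let ?D' = "conj_by G g ` ?D"
  have D'g: "subgroup ?D' G" using subgroup_conj_image[OF g(3) Dg] .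
  have "?D' \<subseteq> conj_by G g ` (conj_by G (inv g) ` M)" unfolding D by blast
  also have "\<dots> = M" using conj_by_image_inv'[OF g(3) subgroup.subset[OF Mg]] .
  finally have D'M: "?D' \<subseteq> M" .
  have D'c: "card ?D' = p ^ d" using card_image[OF inj_on_conj_by[OF g(3) Dsub]] d by simp
  obtain m where m: "card (normalizer G R) = card NR * m" "\<not> p dvd m"
    using fully_normalised_sylow full unfolding \<phi>Q NR_def by blast
  have NGg: "subgroup (normalizer G R) G" using normalizer_imp_subgroup[OF Rsub] .
  interpret NG: group "G\<lparr>carrier := normalizer G R\<rparr>" using NGg by (rule subgroup_imp_group)
  have "card M dvd card (normalizer G R)"
    using NG.card_subgroup_dvd[of M] Mg NGg MN by (simp add: subgroup_restrict_iff order_def)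
  interpret Mg: group "G\<lparr>carrier := M\<rparr>" using Mg by (rule subgroup_imp_group)
  have "card NR dvd card M"
    using Mg.card_subgroup_dvd[of NR] Mg NRg NRM by (simp add: subgroup_restrict_iff order_def)
  then obtain m' where m': "card M = card NR * m'" by blast
  have "card NR \<noteq> 0"
    using finite_sub[OF subgroup.subset[OF NRg]] subgroup.one_closed[OF NRg] by auto
  then have "m' dvd m" using \<open>card M dvd card (normalizer G R)\<close> m(1) m' by simp
  \<comment> \<open>N_P(R) lies in \<open>M\<close>, which lies in N_G(R); its index in
    \<open>M\<close> divides its index in N_G(R) and is therefore prime to p.\<close>
  then have m'p: "\<not> p dvd m'" using m(2) dvd_trans by blast
  have "\<exists>n\<in>M. conj_by G n ` ?D' \<subseteq> NR"
    using Mg.p_subgroup_conj_into[OF p_prime, of NR ?D' d m'] finite_sub[OF subgroup.subset[OF Mg]]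
      Mg NRg NRM D'g D'M D'c m' m'p
    by (auto simp: subgroup_restrict_iff order_def conj_by_consistent)
  then obtain n where n: "n \<in> M" "conj_by G n ` ?D' \<subseteq> NR" by blast
  then obtain y where y: "n \<in> carrier G" "y \<in> NR" "\<And>r. r \<in> R \<Longrightarrow> conj_by G n r = conj_by G y r"
    unfolding M_def by blast
  have yc: "y \<in> carrier G" and yi: "inv y \<in> NR" "inv y \<in> carrier G"
    using NRc[OF y(2)] subgroup.m_inv_closed[OF NRg y(2)] by auto
  \<comment> \<open>\<open>n\<close> moves the conjugated domain into N_P(R) but may act on R as
    \<open>y\<close> does. The factor \<open>inv y\<close> cancels that action and stays within
    N_P(R).\<close>
  define h where "h = inv y \<otimes> (n \<otimes> g)"
  have hc: "h \<in> carrier G" unfolding h_def using yi y g by simp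
  have him: "conj_by G h ` ?D \<subseteq> NR"
  proof -
    have "conj_by G h ` ?D = conj_by G (inv y) ` (conj_by G n ` ?D')"
      unfolding h_def using yi(2) y(1) g(3) Dsub by (simp add: conj_by_image_mult)
    also have "\<dots> \<subseteq> conj_by G (inv y) ` NR" using n(2) by (rule image_mono)
    also have "\<dots> = NR" using conj_by_image_self[OF NRg yi(1)] .
    finally show ?thesis .
  qed
  have hphi: "conj_by G h u = conj_by G g u" if "u \<in> Q" for u
  proof -
    have uc: "u \<in> carrier G" and gu: "conj_by G g u \<in> R" using that Qsub unfolding R_def by auto
    have "conj_by G h u = conj_by G (inv y) (conj_by G n (conj_by G g u))"
      unfolding h_def using yi(2) y(1) g(3) uc by (simp add: conj_by_mult)
    also have "\<dots> = conj_by G g u" using y(3)[OF gu] yc g(3) uc by simp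
    finally show ?thesis .
  qed
  have "R \<subseteq> NR" unfolding NR using conj_by_image_self[OF RG] RP by blast
  then have "Q \<subseteq> conj_by G (inv g) ` M"
    using conj_by_image_inv[OF g(3) Qsub] NRM unfolding R_def by blast
  moreover have "Q \<subseteq> NQ" unfolding NQ using conj_by_image_self[OF g(1)] g(2) by blast
  ultimately have QD: "Q \<subseteq> ?D" unfolding D by blast
  have "conj_by G h ` ?D \<subseteq> P" using him unfolding NR by blast
  then have "restrict (conj_by G h) ?D \<in> mor F ?D P"
    using Dg DP P_subgroup hc by (intro morI) auto
  moreover have "restrict (restrict (conj_by G h) ?D) Q = \<phi>"
    using QD hphi by (auto simp: g(5) fun_eq_iff)
  ultimately show ?thesis by blast
qed

theorem saturated_group_fs: "saturated_fusion_system p F"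
  unfolding saturated_fusion_system_def
  using fusion_on_group_fs sylow_Aut_base mor_extends by simp

end

section \<open>Normal subgroups, solubility and stability\<close>

context sylow_pair
begin

text \<open>Morphisms of F/K see only cosets of K. So in \<open>ext\<close> the extension \<psi> has
  to agree with \<phi> only modulo K, and it may come from a different conjugating element.\<close>

lemma normal_in_quotient:
  assumes K: "K \<lhd> G" and KL: "K \<subseteq> L" and LP: "L \<subseteq> P" and L: "L \<lhd> G\<lparr>carrier := P\<rparr>"
    and ext: "\<And>T R \<phi>. \<phi> \<in> mor F T R \<Longrightarrow> K \<subseteq> T \<Longrightarrow> K \<subseteq> R \<Longrightarrow>
      \<exists>\<psi>\<in>mor F (T <#> L) (R <#> L). (\<forall>x\<in>T. K #> \<psi> x = K #> \<phi> x) \<and> \<psi> ` L = L"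
  shows "normal_in_fs (quot_set (base F) K L) (quotient_fs F K)"
proof -
  let ?B = "G\<lparr>carrier := P\<rparr>"
  let ?q = "quot_set ?B K"
  have q: "?q T = (\<lambda>x. K #> x) ` T" for T by (simp add: quot_set_def)
  have KB: "K \<lhd> ?B" using normal_restrict_supergroup[OF P_subgroup K] KL LP by blast
  interpret KB: normal K ?B using KB .
  have gQ: "group (?B Mod K)" by (rule KB.factorgroup_is_group)
  interpret Q: group "?B Mod K" by (rule gQ)
  have LG: "subgroup L G" using normal_imp_subgroup[OF L] P_subgroup by (simp add: subgroup_restrict_iff)
  have carr: "carrier (?B Mod K) = ?q P" by (simp add: carrier_FactGroup q)
  have "group_hom ?B (?B Mod K) (\<lambda>x. K #> x)"
    using KB.r_coset_hom_Mod KB.is_group gQ by (simp add: group_hom_def group_hom_axioms_def)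
  from normal.surj_hom_normal_subgroup[OF L this] have qL: "?q L \<lhd> ?B Mod K"
    by (simp add: q carr)
  have qLsub: "subgroup (?q L) (?B Mod K)" using normal_imp_subgroup[OF qL] .
  have norm: "normalizer (?B Mod K) (?q L) = carrier (?B Mod K)"
    using qL Q.normal_iff_conj_image Q.normalizer_eq[OF subgroup.subset[OF qLsub]] by auto
  have finQ: "finite (carrier (?B Mod K))"
    unfolding carr q using finite_sub[OF P_sub] by simp
  \<comment> \<open>L/K is normal in P/K, so its normaliser is all of P/K and no other normaliser
    can be larger.\<close>
  have full: "fully_normalised (quotient_fs F K) (?q L)"
    unfolding fully_normalised_def quotient_fs_def base_group_fs fusion_system.simps norm
    using qLsub by (auto simp: normalizer_def stabilizer_def intro!: card_mono finQ)
  have qmult: "?q T <#>\<^bsub>?B Mod K\<^esub> ?q L = ?q (T <#> L)" if T: "T \<subseteq> P" for T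
  proof -
    have "(K #> x) <#> (K #> y) = K #> (x \<otimes> y)" if "x \<in> T" "y \<in> L" for x y
      using KB.rcos_sum[of x y] that T LP by (simp add: subset_iff)
    then show ?thesis by (force simp: set_mult_def q)
  qed
  \<comment> \<open>This is an equality of records. The bases agree by \<open>norm\<close>; for the
    morphisms, only the extension of an arbitrary \<theta> has content.\<close>
  have "normaliser_fs (quotient_fs F K) (?q L) = quotient_fs F K"
  proof -
    have "{\<theta> \<in> mor (quotient_fs F K) A B. A \<subseteq> carrier (?B Mod K) \<and> B \<subseteq> carrier (?B Mod K) \<and>
       (\<exists>\<psi>\<in>mor (quotient_fs F K) (A <#>\<^bsub>?B Mod K\<^esub> ?q L) (B <#>\<^bsub>?B Mod K\<^esub> ?q L).
          restrict \<psi> A = \<theta> \<and> \<psi> ` ?q L = ?q L)} = mor (quotient_fs F K) A B" (is "?S = _") for A B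
    proof (intro equalityI subsetI)
      fix \<theta> assume th: "\<theta> \<in> mor (quotient_fs F K) A B"
      then obtain T R \<phi> where \<phi>: "\<phi> \<in> mor F T R" "K \<subseteq> T" "K \<subseteq> R" and AB: "A = ?q T" "B = ?q R"
        and \<theta>: "\<theta> \<in> extensional A" "\<And>x. x \<in> T \<Longrightarrow> \<theta> (K #> x) = K #> \<phi> x"
        by (auto simp: quotient_fs_def)
      obtain \<psi> where \<psi>: "\<psi> \<in> mor F (T <#> L) (R <#> L)" "\<And>x. x \<in> T \<Longrightarrow> K #> \<psi> x = K #> \<phi> x" "\<psi> ` L = L"
        using ext[OF \<phi>] by blast
      have TP: "T \<subseteq> P" "R \<subseteq> P" and Tg: "subgroup T G" "subgroup R G" using \<phi>(1) by (auto simp: mor_iff)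
      obtain g where g: "g \<in> carrier G" "\<psi> = restrict (conj_by G g) (T <#> L)"
        and TLg: "subgroup (T <#> L) G" using \<psi>(1) by (auto simp: mor_iff)
      note sub = subgroup.subset[OF Tg(1)] subgroup.subset[OF Tg(2)] subgroup.subset[OF LG]
      have TTL: "T \<subseteq> T <#> L" using subset_set_mult_left[OF sub(1) LG] .
      have LTL: "L \<subseteq> T <#> L" using subset_set_mult_right[OF Tg(1) sub(3)] .
      have RRL: "R \<subseteq> R <#> L" using subset_set_mult_left[OF sub(2) LG] .
      \<comment> \<open>As K is normal in G, conjugation by g permutes its cosets in G. The induced
        map is thus \<open>image\<close>, and no representatives have to be chosen.\<close>
      define \<theta>' where "\<theta>' = restrict (\<lambda>X. conj_by G g ` X) (?q (T <#> L))"
      have \<theta>'x: "\<theta>' (K #> x) = K #> \<psi> x" if x: "x \<in> T <#> L" for x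
        using x conj_by_image_r_coset[OF K g(1) subgroup.mem_carrier[OF TLg x]] by (simp add: \<theta>'_def q g(2))
      have "\<theta>' \<in> mor (quotient_fs F K) (?q (T <#> L)) (?q (R <#> L))"
      proof -
        have "\<theta>' \<in> extensional (?q (T <#> L))" by (simp add: \<theta>'_def)
        then have "\<exists>T' R'. \<exists>\<phi>\<in>mor F T' R'. K \<subseteq> T' \<and> K \<subseteq> R' \<and> ?q (T <#> L) = ?q T' \<and>
            ?q (R <#> L) = ?q R' \<and> \<theta>' \<in> extensional (?q (T <#> L)) \<and>
            (\<forall>x\<in>T'. \<theta>' (K #>\<^bsub>?B\<^esub> x) = K #>\<^bsub>?B\<^esub> \<phi> x)"
          using \<psi>(1) \<theta>'x TTL RRL \<phi>(2,3)
          by (intro exI[of _ "T <#> L"] exI[of _ "R <#> L"] bexI[of _ \<psi>]) auto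
        then show ?thesis by (simp add: quotient_fs_def)
      qed
      then have m: "\<theta>' \<in> mor (quotient_fs F K) (A <#>\<^bsub>?B Mod K\<^esub> ?q L) (B <#>\<^bsub>?B Mod K\<^esub> ?q L)"
        unfolding AB qmult[OF TP(1)] qmult[OF TP(2)] .
      have "restrict \<theta>' A = \<theta>"
      proof (rule extensionalityI[of _ A])
        fix X assume X: "X \<in> A"
        then obtain x where x: "x \<in> T" "X = K #> x" unfolding AB q by blast
        show "restrict \<theta>' A X = \<theta> X"
          using X \<theta>'x[of x] TTL x(1) \<psi>(2)[OF x(1)] \<theta>(2)[OF x(1)] unfolding x(2) by auto
      qed (use \<theta> in auto)
      moreover have "\<theta>' ` ?q L = ?q L"
      proof -
        have "\<theta>' ` ?q L = (\<lambda>x. K #> \<psi> x) ` L"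
          unfolding q image_image using \<theta>'x LTL by (intro image_cong) auto
        also have "\<dots> = (\<lambda>x. K #> x) ` (\<psi> ` L)" by (simp add: image_image)
        finally show ?thesis unfolding \<psi>(3) q .
      qed
      ultimately show "\<theta> \<in> ?S" using th m TP unfolding AB carr by (auto simp: q)
    qed auto
    then show ?thesis
      by (simp add: normaliser_fs_def norm) (simp add: quotient_fs_def norm)
  qed
  with full show ?thesis by (simp add: normal_in_fs_def)
qed

text \<open>F/1 lives on singleton cosets and is not literally F, so the first link of the chain
  also passes through the quotient criterion. The same g extends the morphism to TV, since V is
  normal in G.\<close>

lemma normal_in_group_fs_quotient_one:
  assumes V: "V \<lhd> G" "V \<subseteq> P"
  shows "normal_in_fs (quot_set (base F) {\<one>} V) (quotient_fs F {\<one>})"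
proof (rule normal_in_quotient[OF one_is_normal])
  have Vg: "subgroup V G" using normal_imp_subgroup[OF V(1)] .
  show "{\<one>} \<subseteq> V" using subgroup.one_closed[OF Vg] by simp
  show "V \<lhd> G\<lparr>carrier := P\<rparr>" using normal_restrict_supergroup[OF P_subgroup V] .
  fix T R \<phi> assume "\<phi> \<in> mor F T R"
  then obtain g where g: "subgroup T G" "subgroup R G" "T \<subseteq> P" "R \<subseteq> P" "g \<in> carrier G"
    "conj_by G g ` T \<subseteq> R" "\<phi> = restrict (conj_by G g) T" by (auto simp: mor_iff)
  have sub: "H <#> V \<subseteq> P" if "H \<subseteq> P" for H
    using that V(2) subgroup.m_closed[OF P_subgroup] by (fastforce simp: set_mult_def)
  have gV: "conj_by G g ` V = V" using V(1) g(5) by (auto simp: normal_iff_conj_image)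
  have im: "conj_by G g ` (T <#> V) \<subseteq> R <#> V"
  proof
    fix z assume "z \<in> conj_by G g ` (T <#> V)"
    then obtain x v where z: "x \<in> T" "v \<in> V" "z = conj_by G g (x \<otimes> v)"
      by (auto simp: set_mult_def)
    have "z = conj_by G g x \<otimes> conj_by G g v"
      using z g(5) subgroup.mem_carrier[OF g(1)] subgroup.mem_carrier[OF Vg] by (simp add: conj_by_hom)
    moreover have "conj_by G g x \<in> R" "conj_by G g v \<in> V" using z g(6) gV by blast+
    ultimately show "z \<in> R <#> V" by (auto simp: set_mult_def)
  qed
  have TTV: "T \<subseteq> T <#> V" using subset_set_mult_left[OF subgroup.subset[OF g(1)] Vg] .
  have VTV: "V \<subseteq> T <#> V" using subset_set_mult_right[OF g(1) subgroup.subset[OF Vg]] .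
  show "\<exists>\<psi>\<in>mor F (T <#> V) (R <#> V). (\<forall>x\<in>T. {\<one>} #> \<psi> x = {\<one>} #> \<phi> x) \<and> \<psi> ` V = V"
  proof (intro bexI conjI ballI)
    show "restrict (conj_by G g) (T <#> V) \<in> mor F (T <#> V) (R <#> V)"
      using g im sub by (intro morI subgroup_set_mult_normal V(1)) auto
    show "restrict (conj_by G g) (T <#> V) ` V = V"
      using gV VTV by (auto simp: image_def subset_iff)
    show "{\<one>} #> restrict (conj_by G g) (T <#> V) x = {\<one>} #> \<phi> x" if "x \<in> T" for x
      using that TTV by (auto simp: g(7))
  qed
qed (use V in auto)

text \<open>The index is prime, so no subgroup lies strictly between V and P. A morphism of F/V
  therefore starts at V/V or at P/V, and in the latter case it is already defined on the whole
  base.\<close>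

lemma normal_in_group_fs_quotient_prime_index:
  assumes V: "V \<lhd> G" "V \<subseteq> P" "card P = p * card V"
  shows "normal_in_fs (quot_set (base F) V P) (quotient_fs F V)"
proof (rule normal_in_quotient[OF V(1,2)])
  have Vg: "subgroup V G" using normal_imp_subgroup[OF V(1)] .
  have finP: "finite P" using finite_sub[OF P_sub] .
  interpret Pg: group "G\<lparr>carrier := P\<rparr>" using P_subgroup by (rule subgroup_imp_group)
  show "P \<lhd> G\<lparr>carrier := P\<rparr>"
    using Pg.normal_iff_conj_image[of P] conj_by_image_self[OF P_subgroup] P_subgroup
    by (simp add: subgroup_restrict_iff conj_by_consistent)
  fix T R \<phi> assume \<phi>: "\<phi> \<in> mor F T R" and VT: "V \<subseteq> T" "V \<subseteq> R"
  then obtain g where g: "subgroup T G" "subgroup R G" "T \<subseteq> P" "R \<subseteq> P" "g \<in> carrier G"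
    "conj_by G g ` T \<subseteq> R" "\<phi> = restrict (conj_by G g) T" by (auto simp: mor_iff)
  have mP: "H <#> P = P" if "subgroup H G" "H \<subseteq> P" for H
  proof
    show "H <#> P \<subseteq> P" using that subgroup.m_closed[OF P_subgroup] by (fastforce simp: set_mult_def)
    show "P \<subseteq> H <#> P" using subset_set_mult_right[OF that(1) P_sub] .
  qed
  have dv: "card A dvd card B" if "subgroup A G" "subgroup B G" "A \<subseteq> B" for A B
  proof -
    interpret Bg: group "G\<lparr>carrier := B\<rparr>" using that(2) by (rule subgroup_imp_group)
    show ?thesis using Bg.card_subgroup_dvd[of A] that by (simp add: subgroup_restrict_iff order_def)
  qed
  have V0: "card V > 0" using finite_sub[OF subgroup.subset[OF Vg]] subgroup.one_closed[OF Vg] card_gt_0_iff by blast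
  obtain j where j: "card T = card V * j" using dv[OF Vg g(1) VT(1)] by blast
  have "card V * j dvd card V * p" using dv[OF g(1) P_subgroup g(3)] j V(3) by (simp add: mult.commute)
  then have "j dvd p" using V0 by simp
  then have "j = 1 \<or> j = p" using p_prime prime_nat_iff by blast
  then have "T = V \<or> T = P"
  proof
    assume "j = 1"
    then have "V = T" using VT(1) j finite_subset[OF g(3) finP] by (intro card_subset_eq) auto
    then show ?thesis by simp
  next
    assume "j = p"
    then have "T = P" using g(3) j V(3) finP by (intro card_subset_eq) (auto simp: mult.commute)
    then show ?thesis ..
  qed
  then have "\<exists>\<psi>\<in>mor F P P. (\<forall>x\<in>T. V #> \<psi> x = V #> \<phi> x) \<and> \<psi> ` P = P"
  proof
    \<comment> \<open>A morphism defined on V is trivial modulo V, so the identity of P serves as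
      its extension, however \<phi> acts on V itself.\<close>
    assume T: "T = V"
    have gV: "conj_by G g ` V = V" using V(1) g(5) by (auto simp: normal_iff_conj_image)
    show ?thesis
    proof (intro bexI conjI ballI)
      show "restrict (conj_by G \<one>) P \<in> mor F P P"
        using P_subgroup P_sub by (intro morI) (auto simp: subset_iff)
      show "restrict (conj_by G \<one>) P ` P = P" using P_sub by (auto simp: subset_iff image_def)
      fix x assume x: "x \<in> T"
      have "conj_by G g x \<in> V" using x gV unfolding T by blast
      then show "V #> restrict (conj_by G \<one>) P x = V #> \<phi> x"
        using x g(3) P_sub subgroup.rcos_const[OF Vg is_group] unfolding g(7) T by (auto simp: subset_iff)
    qed
  next
    assume T: "T = P"
    have "R = P"
    proof -
      have "card P = card (conj_by G g ` P)"
        using card_image[OF inj_on_conj_by[OF g(5) P_sub]] by simp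
      also have "\<dots> \<le> card R" using card_mono[OF finite_subset[OF g(4) finP] g(6)] unfolding T .
      finally show ?thesis using card_seteq[OF finP g(4)] by simp
    qed
    then have \<phi>P: "\<phi> \<in> mor F P P" using \<phi> T by simp
    have "\<phi> ` P = P"
      using g(6) T \<open>R = P\<close> endo_inj_surj[OF finP _ inj_on_conj_by[OF g(5) P_sub]] by (simp add: g(7))
    with \<phi>P show ?thesis by blast
  qed
  then show "\<exists>\<psi>\<in>mor F (T <#> P) (R <#> P). (\<forall>x\<in>T. V #> \<psi> x = V #> \<phi> x) \<and> \<psi> ` P = P"
    using mP[OF g(1,3)] mP[OF g(2,4)] by simp
qed simp

theorem soluble_group_fs:
  assumes V: "V \<lhd> G" "V \<subseteq> P" "card P = p * card V" "V \<noteq> {\<one>}"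
  shows "soluble_fs F"
proof -
  have Vg: "subgroup V G" using normal_imp_subgroup[OF V(1)] .
  define Q where "Q i = (if i = 0 then {\<one>} else if i = 1 then V else P)" for i :: nat
  have V0: "card V > 0" using finite_sub[OF subgroup.subset[OF Vg]] subgroup.one_closed[OF Vg] card_gt_0_iff by blast
  have "V \<noteq> P" using V(3) V0 prime_gt_1_nat[OF p_prime] by auto
  then have "{\<one>} \<subset> V" "V \<subset> P" using V subgroup.one_closed[OF Vg] by auto
  moreover have "subgroup (Q i) (G\<lparr>carrier := P\<rparr>)" for i
    using Vg V(2) P_subgroup triv_subgroup subgroup.one_closed[OF P_subgroup]
    by (auto simp: Q_def subgroup_restrict_iff)
  moreover have "{1..2::nat} = {1, 2}" by auto
  ultimately show ?thesis
    unfolding soluble_fs_def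
    using normal_in_group_fs_quotient_one[OF V(1,2)] normal_in_group_fs_quotient_prime_index[OF V(1-3)]
    by (intro exI[of _ 2] exI[of _ Q]) (simp add: Q_def)
qed

text \<open>A normal \<open>p\<close>-subgroup of \<open>Aut\<^sub>F(V)\<close> lies in every conjugate of the Sylow subgroup \<open>Aut\<^sub>P(V)\<close>.\<close>

lemma p_core_Aut_trivial:
  assumes V: "V \<lhd> G" "V \<subseteq> P" and s: "s \<in> carrier G"
    and disj: "\<And>x y. x \<in> P \<Longrightarrow> y \<in> P \<Longrightarrow>
      \<forall>a\<in>V. conj_by G x a = conj_by G (conj_by G s y) a \<Longrightarrow> \<forall>a\<in>V. conj_by G x a = a"
  shows "p_core p (Aut_fs F V) \<subseteq> {\<lambda>a\<in>V. a}"
proof -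
  let ?A = "Aut_fs F V" and ?h = "\<lambda>x. restrict (conj_by G x) V"
  have Vg: "subgroup V G" using normal_imp_subgroup[OF V(1)] .
  have NV: "normalizer G V = carrier G"
    using V(1) normalizer_eq[OF subgroup.subset[OF Vg]] by (auto simp: normal_iff_conj_image)
  interpret h: group_hom G ?A ?h
    using group_hom_Aut(1)[OF Vg V(2)] unfolding NV by simp
  have surj: "?h ` carrier G = carrier ?A" using group_hom_Aut(2)[OF Vg V(2)] unfolding NV .
  have one: "\<one>\<^bsub>?A\<^esub> = (\<lambda>a\<in>V. a)" by (simp add: Aut_fs_def BijGroup_def)
  obtain j m where j: "subgroup (?h ` P) ?A" "order ?A = card (?h ` P) * m" "\<not> p dvd m"
    using sylow_Aut[OF Vg V(2)] P_sub unfolding NV by blast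
  have finA: "finite (carrier ?A)" unfolding surj[symmetric] using fin by simp
  have triv: "N \<subseteq> {\<one>\<^bsub>?A\<^esub>}" if N: "N \<lhd> ?A" "card N = p ^ n" for N n
  proof
    have conjN: "conj_by ?A \<alpha> ` N = N" if "\<alpha> \<in> carrier ?A" for \<alpha>
      using N(1) that h.H.normal_iff_conj_image by blast
    have Nsub: "subgroup N ?A" using normal_imp_subgroup[OF N(1)] .
    obtain \<alpha> where "\<alpha> \<in> carrier ?A" "conj_by ?A \<alpha> ` N \<subseteq> ?h ` P"
      using h.H.p_subgroup_conj_into[OF p_prime finA j(1) Nsub N(2) j(2,3)] by blast
    then have NC: "N \<subseteq> ?h ` P" using conjN by simp
    fix \<nu> assume \<nu>: "\<nu> \<in> N"
    obtain x where x: "x \<in> P" "\<nu> = ?h x" using NC \<nu> by blast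
    \<comment> \<open>N equals its conjugate by the image of s, so \<nu> lies both in the image of P
      and in that of s P s^-1; \<open>disj\<close> then leaves only the identity.\<close>
    have "\<nu> \<in> conj_by ?A (?h s) ` N" using conjN[OF h.hom_closed[OF s]] \<nu> by simp
    then obtain y where y: "y \<in> P" "\<nu> = conj_by ?A (?h s) (?h y)" using NC by blast
    have yc: "y \<in> carrier G" using y(1) P_sub by blast
    have "?h (conj_by G s y) = ?h (s \<otimes> y) \<otimes>\<^bsub>?A\<^esub> ?h (inv s)"
      unfolding conj_by_def[of G s y] by (rule h.hom_mult) (use s yc in auto)
    also have "\<dots> = conj_by ?A (?h s) (?h y)"
      unfolding conj_by_def[of ?A] h.hom_mult[OF s yc] h.hom_inv[OF s] ..
    finally have "?h (conj_by G s y) = conj_by ?A (?h s) (?h y)" .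
    then have eq: "?h x = ?h (conj_by G s y)" using x(2) y(2) by simp
    have "conj_by G x a = conj_by G (conj_by G s y) a" if "a \<in> V" for a
      using fun_cong[OF eq, of a] that by simp
    then have "conj_by G x a = a" if "a \<in> V" for a using disj[OF x(1) y(1)] that by blast
    then show "\<nu> \<in> {\<one>\<^bsub>?A\<^esub>}" unfolding one x(2) by (auto simp: fun_eq_iff)
  qed
  show ?thesis
    unfolding p_core_def one[symmetric]
    by (rule h.H.generate_subgroup_incl[OF _ h.H.triv_subgroup]) (use triv in blast)
qed

text \<open>\<open>disj\<close> says that P and s P s^-1 have images in Aut_F(V) meeting only in the
  identity, which makes the p-core trivial. Conjugation by t satisfies the stability condition on V
  but is not the identity there.\<close>

theorem not_p_stable_group_fs:
  assumes V: "V \<lhd> G" "V \<subseteq> P" and s: "s \<in> carrier G"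
    and disj: "\<And>x y. x \<in> P \<Longrightarrow> y \<in> P \<Longrightarrow>
      \<forall>a\<in>V. conj_by G x a = conj_by G (conj_by G s y) a \<Longrightarrow> \<forall>a\<in>V. conj_by G x a = a"
    and t: "t \<in> carrier G" "a \<in> V" "conj_by G t a \<noteq> a"
    and quadratic: "\<And>a. a \<in> V \<Longrightarrow>
      conj_by G t (inv a) \<otimes> a \<otimes> conj_by G t (inv a) \<otimes> conj_by G t (conj_by G t a) = \<one>"
  shows "\<not> p_stable p F"
proof
  assume stable: "p_stable p F"
  let ?\<chi> = "restrict (conj_by G t) V"
  have Vg: "subgroup V G" using normal_imp_subgroup[OF V(1)] .
  have img: "conj_by G g ` V = V" if "g \<in> carrier G" for g
    using V(1) that by (auto simp: normal_iff_conj_image)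
  \<comment> \<open>V is normal in G and hence its own only conjugate in F.\<close>
  have "fully_normalised F V"
    unfolding fully_normalised_def base_group_fs
  proof (intro conjI allI ballI)
    show "subgroup V (G\<lparr>carrier := P\<rparr>)" using Vg V(2) P_subgroup by (simp add: subgroup_restrict_iff)
    fix R \<phi> assume "\<phi> \<in> mor F V R"
    then obtain g where "g \<in> carrier G" "\<phi> = restrict (conj_by G g) V" by (auto simp: mor_iff)
    then have "\<phi> ` V = V" using img by simp
    then show "card (normalizer (G\<lparr>carrier := P\<rparr>) (\<phi> ` V)) \<le> card (normalizer (G\<lparr>carrier := P\<rparr>) V)" by simp
  qed
  moreover have "?\<chi> \<in> mor F V V" using Vg V(2) t(1) img by (intro morI) auto
  moreover have "\<forall>a\<in>V. ?\<chi> (inv\<^bsub>base F\<^esub> a) \<otimes>\<^bsub>base F\<^esub> a \<otimes>\<^bsub>base F\<^esub> ?\<chi> (inv\<^bsub>base F\<^esub> a)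
      \<otimes>\<^bsub>base F\<^esub> ?\<chi> (?\<chi> a) = \<one>\<^bsub>base F\<^esub>"
  proof
    fix a assume a: "a \<in> V"
    have "conj_by G t a \<in> V" using img[OF t(1)] a by blast
    moreover have "inv\<^bsub>G\<lparr>carrier := P\<rparr>\<^esub> a = inv a" using a V(2) P_subgroup m_inv_consistent by blast
    ultimately show "?\<chi> (inv\<^bsub>base F\<^esub> a) \<otimes>\<^bsub>base F\<^esub> a \<otimes>\<^bsub>base F\<^esub> ?\<chi> (inv\<^bsub>base F\<^esub> a)
      \<otimes>\<^bsub>base F\<^esub> ?\<chi> (?\<chi> a) = \<one>\<^bsub>base F\<^esub>"
      using a quadratic[OF a] subgroup.m_inv_closed[OF Vg a] by simp
  qed
  ultimately have "?\<chi> \<in> p_core p (Aut_fs F V)"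
    using stable unfolding p_stable_def by blast
  moreover have "p_core p (Aut_fs F V) \<subseteq> {\<lambda>a\<in>V. a}"
    using V s disj by (rule p_core_Aut_trivial)
  ultimately have "?\<chi> = (\<lambda>a\<in>V. a)" by (meson singletonD subsetD)
  from fun_cong[OF this, of a] show False using t by simp
qed

end

section \<open>The affine special linear group\<close>

locale prime_affine =
  fixes p :: nat
  assumes prime_p: "Factorial_Ring.prime p"
begin

text \<open>\<open>aff a b c d e f\<close> encodes the affine map \<open>(x, y) \<mapsto> (a x + b y + e, c x + d y + f)\<close> modulo \<open>p\<close>.\<close>

definition aff :: "int \<Rightarrow> int \<Rightarrow> int \<Rightarrow> int \<Rightarrow> int \<Rightarrow> int \<Rightarrow> nat" where
  "aff a b c d e f =
     to_nat (a mod int p, b mod int p, c mod int p, d mod int p, e mod int p, f mod int p)"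

text \<open>Composition of affine maps: with linear parts A, B and translation vectors v, w, the
  product has linear part AB and translation vector Aw + v.\<close>

definition aff_mult :: "nat \<Rightarrow> nat \<Rightarrow> nat" where
  "aff_mult m n =
     (case (from_nat m :: int \<times> int \<times> int \<times> int \<times> int \<times> int) of (a, b, c, d, e, f) \<Rightarrow>
      case (from_nat n :: int \<times> int \<times> int \<times> int \<times> int \<times> int) of (a', b', c', d', e', f') \<Rightarrow>
        aff (a * a' + b * c') (a * b' + b * d') (c * a' + d * c') (c * b' + d * d')
          (a * e' + b * f' + e) (c * e' + d * f' + f))"

text \<open>\<open>aff\<close> is not injective, but the determinant modulo p does not depend on the
  integers chosen to represent a code.\<close>

definition ASL :: "nat monoid" where
  "ASL = \<lparr>carrier = {aff a b c d e f | a b c d e f. (a * d - b * c) mod int p = 1},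
          monoid.mult = aff_mult, one = aff 1 0 0 1 0 0\<rparr>"

definition transl :: "int \<Rightarrow> int \<Rightarrow> nat" where
  "transl e f = aff 1 0 0 1 e f"

definition V where "V = {transl e f | e f. True}"

text \<open>The full preimage of the upper unitriangular Sylow p-subgroup of SL_2(p).\<close>

definition P where "P = {aff 1 b 0 1 e f | b e f. True}"

lemma p_gt_1: "int p > 1"
  using prime_gt_1_nat[OF prime_p] by simp

lemma one_mod [simp]: "1 mod int p = 1"
  using p_gt_1 by simp

lemma aff_eq_iff:
  "aff a b c d e f = aff a' b' c' d' e' f' \<longleftrightarrow>
     a mod int p = a' mod int p \<and> b mod int p = b' mod int p \<and> c mod int p = c' mod int p \<and>
     d mod int p = d' mod int p \<and> e mod int p = e' mod int p \<and> f mod int p = f' mod int p"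
  by (auto simp: aff_def)

text \<open>Reduction modulo p commutes with sums and products, so codes can be multiplied through
  unreduced integer representatives; the matrix computations below rest on this.\<close>

lemma aff_mult [simp]:
  "aff a b c d e f \<otimes>\<^bsub>ASL\<^esub> aff a' b' c' d' e' f' =
     aff (a * a' + b * c') (a * b' + b * d') (c * a' + d * c') (c * b' + d * d')
       (a * e' + b * f' + e) (c * e' + d * f' + f)"
proof -
  have "(x mod int p * (y mod int p) + z mod int p * (w mod int p)) mod int p = (x * y + z * w) mod int p"
    for x y z w by (intro mod_add_cong mod_mult_cong) simp_all
  moreover have "(x mod int p * (y mod int p) + z mod int p * (w mod int p) + v mod int p) mod int p
      = (x * y + z * w + v) mod int p"
    for x y z w v by (intro mod_add_cong mod_mult_cong) simp_all
  ultimately show ?thesis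
    by (simp add: ASL_def aff_mult_def) (simp add: aff_def)
qed

lemma one_ASL [simp]: "\<one>\<^bsub>ASL\<^esub> = aff 1 0 0 1 0 0"
  by (simp add: ASL_def)

lemma carrier_ASL: "carrier ASL = {aff a b c d e f | a b c d e f. (a * d - b * c) mod int p = 1}"
  by (simp add: ASL_def)

lemma aff_in_carrier [intro]: "(a * d - b * c) mod int p = 1 \<Longrightarrow> aff a b c d e f \<in> carrier ASL"
  unfolding carrier_ASL by blast

lemma group_ASL: "group ASL"
proof (rule groupI)
  show "\<one>\<^bsub>ASL\<^esub> \<in> carrier ASL" by (auto simp: intro!: aff_in_carrier)
next
  fix x y z assume x: "x \<in> carrier ASL" and y: "y \<in> carrier ASL" and z: "z \<in> carrier ASL"
  obtain a b c d e f where x: "x = aff a b c d e f" "(a * d - b * c) mod int p = 1"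
    using x by (auto simp: carrier_ASL)
  obtain a' b' c' d' e' f' where y: "y = aff a' b' c' d' e' f'" "(a' * d' - b' * c') mod int p = 1"
    using y by (auto simp: carrier_ASL)
  obtain a'' b'' c'' d'' e'' f'' where z: "z = aff a'' b'' c'' d'' e'' f''"
    using z by (auto simp: carrier_ASL)
  \<comment> \<open>Multiplicativity of the determinant.\<close>
  have "(a * a' + b * c') * (c * b' + d * d') - (a * b' + b * d') * (c * a' + d * c')
      = (a * d - b * c) * (a' * d' - b' * c')" by (simp add: algebra_simps)
  then have "((a * a' + b * c') * (c * b' + d * d') - (a * b' + b * d') * (c * a' + d * c')) mod int p
      = ((a * d - b * c) mod int p * ((a' * d' - b' * c') mod int p)) mod int p"
    by (simp only: mod_mult_eq)
  then show "x \<otimes>\<^bsub>ASL\<^esub> y \<in> carrier ASL" unfolding x(1) y(1) aff_mult x(2) y(2)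
    by (intro aff_in_carrier) simp
  show "x \<otimes>\<^bsub>ASL\<^esub> y \<otimes>\<^bsub>ASL\<^esub> z = x \<otimes>\<^bsub>ASL\<^esub> (y \<otimes>\<^bsub>ASL\<^esub> z)"
    unfolding x(1) y(1) z aff_mult by (simp add: algebra_simps)
  show "\<one>\<^bsub>ASL\<^esub> \<otimes>\<^bsub>ASL\<^esub> x = x" unfolding x(1) one_ASL aff_mult by simp
  show "\<exists>w\<in>carrier ASL. w \<otimes>\<^bsub>ASL\<^esub> x = \<one>\<^bsub>ASL\<^esub>"
  proof
    \<comment> \<open>The linear part is the adjugate, which inverts a matrix A of determinant 1;
      the translation vector is the negative of A^-1 applied to (e, f).\<close>
    show "aff d (- b) (- c) a (b * f - d * e) (c * e - a * f) \<in> carrier ASL"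
      using x(2) by (intro aff_in_carrier) (simp add: mult.commute)
    show "aff d (- b) (- c) a (b * f - d * e) (c * e - a * f) \<otimes>\<^bsub>ASL\<^esub> x = \<one>\<^bsub>ASL\<^esub>"
      using x(2) unfolding x(1) aff_mult one_ASL aff_eq_iff by (simp add: algebra_simps)
  qed
qed

sublocale ASL: group ASL by (rule group_ASL)

section \<open>Translations and the action on them\<close>

lemma transl_eq_iff:
  "transl e f = transl e' f' \<longleftrightarrow> e mod int p = e' mod int p \<and> f mod int p = f' mod int p"
  by (auto simp: transl_def aff_eq_iff)

lemma transl_in_carrier [simp]: "transl e f \<in> carrier ASL"
  by (auto simp: transl_def intro!: aff_in_carrier)

lemma one_transl: "\<one>\<^bsub>ASL\<^esub> = transl 0 0"
  by (simp add: transl_def)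

lemma transl_in_V [simp]: "transl e f \<in> V"
  unfolding V_def by blast

lemma V_cases:
  assumes "v \<in> V" obtains e f where "v = transl e f"
  using assms unfolding V_def by blast

lemma transl_mult: "transl e f \<otimes>\<^bsub>ASL\<^esub> transl e' f' = transl (e + e') (f + f')"
  by (simp add: transl_def add.commute)

lemma inv_transl: "inv\<^bsub>ASL\<^esub> transl e f = transl (- e) (- f)"
  by (rule ASL.inv_equality) (simp_all add: transl_mult one_transl del: one_ASL)

text \<open>The conjugation action on V is the natural action of the linear part on vectors.
  Everything about Aut_F(V) thereby becomes a computation with matrices.\<close>

lemma conj_transl:
  assumes "(a * d - b * c) mod int p = 1"
  shows "conj_by ASL (aff a b c d e f) (transl x y) = transl (a * x + b * y) (c * x + d * y)"
proof -
  let ?g = "aff a b c d e f"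
  have g: "?g \<in> carrier ASL" using assms by (rule aff_in_carrier)
  have "?g \<otimes>\<^bsub>ASL\<^esub> transl x y = transl (a * x + b * y) (c * x + d * y) \<otimes>\<^bsub>ASL\<^esub> ?g"
    by (simp add: transl_def algebra_simps)
  then show ?thesis using g by (simp add: conj_by_def ASL.m_assoc del: aff_mult one_ASL)
qed

lemma V_normal: "V \<lhd> ASL"
  unfolding ASL.normal_inv_iff
proof (intro conjI ballI)
  show "subgroup V ASL"
  proof (rule ASL.subgroupI)
    show "V \<subseteq> carrier ASL" "V \<noteq> {}" by (auto simp: V_def)
    show "inv\<^bsub>ASL\<^esub> a \<in> V" if "a \<in> V" for a
      using that by (auto elim!: V_cases simp: inv_transl)
    show "a \<otimes>\<^bsub>ASL\<^esub> b \<in> V" if "a \<in> V" "b \<in> V" for a b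
      using that by (auto elim!: V_cases simp: transl_mult)
  qed
  fix g h assume "g \<in> carrier ASL" "h \<in> V"
  then show "g \<otimes>\<^bsub>ASL\<^esub> h \<otimes>\<^bsub>ASL\<^esub> inv\<^bsub>ASL\<^esub> g \<in> V"
    unfolding conj_by_def[symmetric] by (auto simp: carrier_ASL conj_transl elim!: V_cases)
qed

lemma finite_ASL: "finite (carrier ASL)"
proof -
  let ?I = "{0..<int p}"
  have "carrier ASL \<subseteq> to_nat ` (?I \<times> ?I \<times> ?I \<times> ?I \<times> ?I \<times> ?I)"
    using p_gt_1 by (auto simp: carrier_ASL aff_def)
  then show ?thesis by (rule finite_subset) auto
qed

lemma card_V: "card V = p ^ 2"
proof -
  let ?I = "{0..<int p}"
  have "V = (\<lambda>(e, f). transl e f) ` (?I \<times> ?I)"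
  proof
    show "V \<subseteq> (\<lambda>(e, f). transl e f) ` (?I \<times> ?I)"
    proof
      fix v assume "v \<in> V"
      then obtain e f where "v = transl e f" by (auto simp: V_def)
      then have "v = transl (e mod int p) (f mod int p)" by (simp add: transl_eq_iff)
      then show "v \<in> (\<lambda>(e, f). transl e f) ` (?I \<times> ?I)" using p_gt_1 by (intro image_eqI[of _ _ "(e mod int p, f mod int p)"]) auto
    qed
  qed (auto simp: V_def)
  moreover have "inj_on (\<lambda>(e, f). transl e f) (?I \<times> ?I)"
    by (auto simp: inj_on_def transl_eq_iff)
  ultimately show ?thesis by (simp add: card_image card_cartesian_product power2_eq_square)
qed

lemma card_P: "card P = p * card V"
proof -
  let ?I = "{0..<int p}"
  have "P = (\<lambda>(b, e, f). aff 1 b 0 1 e f) ` (?I \<times> ?I \<times> ?I)"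
  proof
    show "P \<subseteq> (\<lambda>(b, e, f). aff 1 b 0 1 e f) ` (?I \<times> ?I \<times> ?I)"
    proof
      fix v assume "v \<in> P"
      then obtain b e f where "v = aff 1 b 0 1 e f" by (auto simp: P_def)
      then have "v = aff 1 (b mod int p) 0 1 (e mod int p) (f mod int p)" by (simp add: aff_eq_iff)
      then show "v \<in> (\<lambda>(b, e, f). aff 1 b 0 1 e f) ` (?I \<times> ?I \<times> ?I)"
        using p_gt_1 by (intro image_eqI[of _ _ "(b mod int p, e mod int p, f mod int p)"]) auto
    qed
  qed (auto simp: P_def)
  moreover have "inj_on (\<lambda>(b, e, f). aff 1 b 0 1 e f) (?I \<times> ?I \<times> ?I)"
    by (auto simp: inj_on_def aff_eq_iff)
  ultimately show ?thesis by (simp add: card_image card_cartesian_product card_V power2_eq_square)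
qed

lemma inverse_mod_p:
  assumes "\<not> int p dvd a" shows "\<exists>x. (a * x) mod int p = 1"
proof -
  have "coprime a (int p)"
    using prime_imp_coprime[of "int p" a] assms prime_p by (simp add: coprime_commute)
  then obtain u v where "u * a + v * int p = 1" using bezout_int[of a "int p"] by (auto simp: coprime_iff_gcd_eq_1)
  then have "a * u = 1 + (- v) * int p" by (simp add: algebra_simps)
  then have "(a * u) mod int p = 1" by (simp only: mod_mult_self1 one_mod)
  then show ?thesis ..
qed

text \<open>\<open>P\<close> is the stabiliser, under conjugation, of a nonzero translation, and \<open>SL\<^sub>2(p)\<close> is
  transitive on the \<open>p\<^sup>2 - 1\<close> nonzero vectors.\<close>

lemma P_subgroup: "subgroup P ASL"
  and order_ASL: "order ASL = card P * (p ^ 2 - 1)"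
proof -
  let ?\<phi> = "\<lambda>g. \<lambda>h\<in>carrier ASL. g \<otimes>\<^bsub>ASL\<^esub> h \<otimes>\<^bsub>ASL\<^esub> inv\<^bsub>ASL\<^esub> g"
  let ?v = "transl 1 0"
  interpret act: group_action ASL "carrier ASL" ?\<phi> by (rule ASL.action_by_conjugation)
  have \<phi>: "?\<phi> g ?v = conj_by ASL g ?v" for g by (simp add: conj_by_def)
  have stab: "stabilizer ASL ?\<phi> ?v = P"
  proof
    show "P \<subseteq> stabilizer ASL ?\<phi> ?v"
      unfolding stabilizer_def \<phi> by (auto simp: P_def conj_transl)
    show "stabilizer ASL ?\<phi> ?v \<subseteq> P"
    proof
      fix g assume "g \<in> stabilizer ASL ?\<phi> ?v"
      then have g: "g \<in> carrier ASL" "conj_by ASL g ?v = ?v" unfolding stabilizer_def \<phi> by auto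
      then obtain a b c d e f where abc: "g = aff a b c d e f" "(a * d - b * c) mod int p = 1"
        by (auto simp: carrier_ASL)
      have ac: "a mod int p = 1" "c mod int p = 0"
        using g(2) abc by (auto simp: conj_transl transl_eq_iff)
      \<comment> \<open>Fixing the vector (1, 0) prescribes the first column; determinant 1 then
        forces the last diagonal entry to be 1.\<close>
      have "(a * d - b * c) mod int p = ((a mod int p) * d - b * (c mod int p)) mod int p"
          by (intro mod_diff_cong mod_mult_cong) simp_all
      then have "d mod int p = 1" using ac abc(2) by simp
      then have "g = aff 1 b 0 1 e f" using ac unfolding abc(1) aff_eq_iff by simp
      then show "g \<in> P" by (auto simp: P_def)
    qed
  qed
  show "subgroup P ASL" using act.stabilizer_subgroup[of ?v] unfolding stab by simp
  have "orbit ASL ?\<phi> ?v = V - {transl 0 0}"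
  proof
    show "orbit ASL ?\<phi> ?v \<subseteq> V - {transl 0 0}"
    proof
      fix w assume "w \<in> orbit ASL ?\<phi> ?v"
      then obtain g where g: "g \<in> carrier ASL" "w = conj_by ASL g ?v" unfolding orbit_def \<phi> by blast
      then obtain a b c d e f where abc: "g = aff a b c d e f" "(a * d - b * c) mod int p = 1"
        by (auto simp: carrier_ASL)
      have w: "w = transl a c" using g(2) abc by (simp add: conj_transl)
      have "w \<noteq> transl 0 0"
      proof
        assume "w = transl 0 0"
        then have "a mod int p = 0" "c mod int p = 0" unfolding w transl_eq_iff by auto
        then have "int p dvd a * d - b * c" by (auto simp: mod_eq_0_iff_dvd)
        then show False using abc(2) by simp
      qed
      then show "w \<in> V - {transl 0 0}" unfolding w by (auto simp: V_def)
    qed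
    show "V - {transl 0 0} \<subseteq> orbit ASL ?\<phi> ?v"
    proof
      fix w assume w: "w \<in> V - {transl 0 0}"
      then obtain a c where ac: "w = transl a c" by (auto simp: V_def)
      then have "\<not> int p dvd a \<or> \<not> int p dvd c"
        using w by (auto simp: transl_eq_iff)
      \<comment> \<open>The vector (a, c) is to be completed, as first column, to a matrix of
        determinant 1. Inverting whichever entry is nonzero modulo p gives b = 0, d = a^-1 or b =
        -c^-1, d = 0.\<close>
      then obtain b d where bd: "(a * d - b * c) mod int p = 1"
      proof
        assume "\<not> int p dvd a"
        then obtain x where "(a * x) mod int p = 1" using inverse_mod_p by blast
        then show ?thesis using that[of x 0] by simp
      next
        assume "\<not> int p dvd c"
        then obtain x where "(c * x) mod int p = 1" using inverse_mod_p by blast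
        then show ?thesis using that[of 0 "- x"] by (simp add: mult.commute)
      qed
      have "w = conj_by ASL (aff a b c d 0 0) ?v" using bd by (simp add: conj_transl ac)
      then show "w \<in> orbit ASL ?\<phi> ?v" using aff_in_carrier[OF bd] unfolding orbit_def \<phi> by blast
    qed
  qed
  moreover have "transl 0 0 \<in> V" by (auto simp: V_def)
  ultimately have "card (orbit ASL ?\<phi> ?v) = p ^ 2 - 1" by (simp add: card_V)
  then show "order ASL = card P * (p ^ 2 - 1)"
    using act.orbit_stabilizer_theorem[of ?v] unfolding stab by (simp add: mult.commute)
qed

section \<open>The required properties of the affine example\<close>

sublocale sylow_pair ASL p P
proof (intro sylow_pair.intro sylow_pair_axioms.intro group_ASL)
  show "Factorial_Ring.prime p" by (rule prime_p)
  show "finite (carrier ASL)" by (rule finite_ASL)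
  show "subgroup P ASL" by (rule P_subgroup)
  show "\<exists>k. card P = p ^ k" unfolding card_P card_V by (rule exI[of _ 3]) (simp add: eval_nat_numeral)
  \<comment> \<open>The index p^2 - 1 is congruent to -1 modulo p.\<close>
  have "\<not> p dvd p ^ 2 - 1"
  proof
    assume "p dvd p ^ 2 - 1"
    moreover have "p dvd p ^ 2" by simp
    moreover have "p ^ 2 \<ge> 1" using prime_gt_1_nat[OF prime_p] by simp
    ultimately have "p dvd p ^ 2 - (p ^ 2 - 1)" using dvd_diff_nat[of p "p ^ 2" "p ^ 2 - 1"] by simp
    then have "p dvd 1" using \<open>p ^ 2 \<ge> 1\<close> by simp
    then show False using prime_gt_1_nat[OF prime_p] by simp
  qed
  then show "\<exists>m. order ASL = card P * m \<and> \<not> p dvd m" using order_ASL by blast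
qed

lemma V_sub_P: "V \<subseteq> P"
  by (auto simp: V_def P_def transl_def)

lemma soluble_ASL: "soluble_fs (group_fs ASL P)"
proof (rule soluble_group_fs[OF V_normal V_sub_P card_P])
  have "transl 1 0 \<in> V" "transl 1 0 \<noteq> \<one>\<^bsub>ASL\<^esub>"
    by (simp_all add: one_transl transl_eq_iff del: one_ASL)
  then show "V \<noteq> {\<one>\<^bsub>ASL\<^esub>}" by blast
qed

lemma not_p_stable_ASL: "\<not> p_stable p (group_fs ASL P)"
proof (rule not_p_stable_group_fs[OF V_normal V_sub_P])
  \<comment> \<open>\<open>?s\<close> is the quarter turn, which conjugates upper unitriangular
    matrices into lower ones; \<open>?t\<close> is the transvection that fixes (1, 0) and sends (0,
    1) to (1, 1).\<close>
  let ?s = "aff 0 (- 1) 1 0 0 0" and ?t = "aff 1 1 0 1 0 0"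
  show s: "?s \<in> carrier ASL" and "?t \<in> carrier ASL" by (auto intro!: aff_in_carrier)
  show "transl 0 1 \<in> V" by (auto simp: V_def)
  show "conj_by ASL ?t (transl 0 1) \<noteq> transl 0 1" by (simp add: conj_transl transl_eq_iff)
  show "conj_by ASL ?t (inv\<^bsub>ASL\<^esub> a) \<otimes>\<^bsub>ASL\<^esub> a \<otimes>\<^bsub>ASL\<^esub> conj_by ASL ?t (inv\<^bsub>ASL\<^esub> a)
      \<otimes>\<^bsub>ASL\<^esub> conj_by ASL ?t (conj_by ASL ?t a) = \<one>\<^bsub>ASL\<^esub>" if "a \<in> V" for a
    using that by (auto simp: V_def inv_transl conj_transl transl_mult one_transl simp del: one_ASL)
  fix x y assume x: "x \<in> P" and y: "y \<in> P"
    and eq: "\<forall>a\<in>V. conj_by ASL x a = conj_by ASL (conj_by ASL ?s y) a"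
  obtain b e f where x: "x = aff 1 b 0 1 e f" using x by (auto simp: P_def)
  obtain b' e' f' where y': "y = aff 1 b' 0 1 e' f'" using y by (auto simp: P_def)
  have yc: "y \<in> carrier ASL" unfolding y' by (auto intro!: aff_in_carrier)
  let ?a = "transl 1 0"
  have sy: "conj_by ASL ?s y \<otimes>\<^bsub>ASL\<^esub> ?s = ?s \<otimes>\<^bsub>ASL\<^esub> y"
    using s yc by (simp add: conj_by_def ASL.m_assoc del: aff_mult one_ASL)
  \<comment> \<open>The test vector is (0, 1), the image of (1, 0) under \<open>?s\<close>. As y
    fixes (1, 0), its conjugate by \<open>?s\<close> fixes (0, 1), whereas x sends (0, 1) to (b, 1);
    so b vanishes modulo p.\<close>
  have "conj_by ASL x (conj_by ASL ?s ?a) = conj_by ASL (conj_by ASL ?s y) (conj_by ASL ?s ?a)"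
    using eq by (auto simp: conj_transl V_def)
  also have "\<dots> = conj_by ASL (?s \<otimes>\<^bsub>ASL\<^esub> y) ?a"
    unfolding sy[symmetric] using s yc by (simp add: ASL.conj_by_mult del: aff_mult)
  also have "\<dots> = conj_by ASL ?s (conj_by ASL y ?a)"
    using s yc by (simp add: ASL.conj_by_mult del: aff_mult)
  finally have "b mod int p = 0" unfolding x y' by (simp add: conj_transl transl_eq_iff)
  then show "\<forall>a\<in>V. conj_by ASL x a = a"
    unfolding x by (auto simp: V_def conj_transl transl_eq_iff mod_eq_0_iff_dvd mod_eq_dvd_iff)
qed

end

theorem proposition6p6:
  fixes p :: nat
  assumes "Factorial_Ring.prime p" and "odd p"
  shows "\<exists>F :: nat fusion_system.
           saturated_fusion_system p F \<and> soluble_fs F \<and> \<not> p_stable p F"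
proof -
  interpret prime_affine p using assms(1) by unfold_locales
  show ?thesis using saturated_group_fs soluble_ASL not_p_stable_ASL by blast
qed

end
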